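(* Let $O_0=\{C_1,\dots,C_m\}$ be an octree (with neighbouring cells differing by at most one level) on the domain $[0,a_x]\times[0,a_y]\times[0,a_z]$, let $O_n$ be its $n$-times uniform refinement, and let $\tau_{k,\boldsymbol i}$ be the localized estimator of condition number at the subcell $C_{k,\boldsymbol i}\in O_n$, for the finite volume matrix $A$ on $O_n$ of the variable coefficient Poisson equation with coefficient $\sigma$ and the octree order. Then there exists a constant $c$ such that for any $n\in\mathbb N$, any $k$ and any $\boldsymbol i\in\{1,\dots,2^n\}^3$, $$\tau_{k,\boldsymbol i}\le c\cdot2^n .$$
   Context: Octree: the root grid $R_0$ is a uniform grid of cubic cells of length $h$; an octree is obtained by finitely many steps $R_{i+1}=(R_i\setminus\{C\})\cup\mathcal R(C)$, $C\in R_i$, where $\mathcal R(C)$ is the set of eight equal subcubes of $C$. $\ell_C$ is the edge length of $C$, and the level $\mathcal L(C)=l$ means $\ell_C=2^{-l}h$. $n_0(C)$ is the set of cells other than $C$ sharing (part of) a face with $C$. Standing condition: $|\mathcal L(C_1)-\mathcal L(C_2)|\le1$ if $C_1\in n_0(C_2)$. The paper's discussion focuses on cubic domains. Octree order $\prec_O$: on $R_0$ it is the lexicographic order. On $R_{i+1}=(R_i\setminus\{C\})\cup\mathcal R(C)$: two cells of $R_i\setminus\{C\}$ are ordered as in $R_i$; a cell of $R_i\setminus\{C\}$ and a cell of $\mathcal R(C)$ are ordered as that cell and $C$ are in $R_i$; two cells of $\mathcal R(C)$ are ordered lexicographically. Uniform refinement: $O_{n+1}=\bigcup_{C\in O_n}\mathcal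 R(C)$. Each $C_k\in O_0$ is divided into $2^n\times2^n\times2^n$ subcells in $O_n$; $C_{k,\boldsymbol i}$, $\boldsymbol i\in\{1,\dots,2^n\}^3$, denotes the $\boldsymbol i$-th subcell (indices increasing along the coordinate axes). Matrix: $\sigma>0$ is a $C^1$ coefficient function on the domain $\Omega$ in $-\nabla\cdot(\sigma\nabla u)=f$ with Dirichlet boundary condition; $\sigma_C$ is the value of $\sigma$ at the center of $C$; $\bar B(C)$ is the number of faces of $C$ contained in $\partial\Omega$; $\alpha=\frac23$. The symmetric matrix $A$, indexed by the cells, is $$A_{C_1,C_2}=\begin{cases}-2\ell_{C_1}(\sigma_{C_1}^{-1}+\sigma_{C_2}^{-1})^{-1}&C_2\in n_0(C_1),\ \mathcal L(C_1)=\mathcal L(C_2),\\-3\alpha\ell_{C_1}(\sigma_{C_1}^{-1}+2\sigma_{C_2}^{-1})^{-1}&C_2\in n_0(C_1),\ \mathcal L(C_1)=\mathcal L(C_2)+1,\\-\sum_{C'\in n_0(C)}A_{C,C'}+2\ell_C\bar B(C)\sigma_C&C_1=C_2=C,\\0&\text{non-neighbouring }C_1\ne C_2,\end{cases}$$ with $A_{C_1,C_2}=A_{C_2,C_1}$. It is assumed that there is a constant $P_\sigma$ such that $|\sigma_{C_2}/\sigma_{C_1}-1|\le P_\sigma/2^{n+1}$ for all neighbouring cells $C_1,C_2$ of $O_n$. MILU and LECN: with $p(K)=\{K'\in n_0(K):K'\prec_OK\}$ and $s(K)=\{K'\in n_0(K):K\prec_OK'\}$, recursively along $\prec_O$ $$e_K=A_{K,K}-\sum_{K_1\in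 p(K)}\sum_{K_2\in s(K_1)}\frac{A_{K,K_1}A_{K_1,K_2}}{e_{K_1}},\qquad \tau_K=\frac{e_K}{e_K+\sum_{K_1\in s(K)}A_{K,K_1}},$$ and $\tau_{k,\boldsymbol i}=\tau_{C_{k,\boldsymbol i}}$. *)

theory Defs
  imports "HOL-Analysis.Analysis"
begin

section \<open>Cells\<close>

text \<open>Every cell of an octree over a root grid of mesh size \<open>h\<close> at the origin has the form
  \<open>\<Prod>d [i_d \<ell>, (i_d + 1) \<ell>]\<close> with \<open>\<ell> = h / 2 ^ l\<close>, so it is encoded by its level \<open>l\<close> and its
  integer position \<open>i\<close>. For \<open>h > 0\<close> distinct codes denote distinct cubes.\<close>

datatype cell = Cell (level: nat) (index: "nat ^ 3")

definition edge :: "real \<Rightarrow> cell \<Rightarrow> real" where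
  "edge h C = h / 2 ^ level C"

definition lower :: "real \<Rightarrow> cell \<Rightarrow> real ^ 3" where
  "lower h C = (\<chi> d. real (index C $ d) * edge h C)"

definition upper :: "real \<Rightarrow> cell \<Rightarrow> real ^ 3" where
  "upper h C = (\<chi> d. (real (index C $ d) + 1) * edge h C)"

definition cube :: "real \<Rightarrow> cell \<Rightarrow> (real ^ 3) set" where
  "cube h C = cbox (lower h C) (upper h C)"

definition center :: "real \<Rightarrow> cell \<Rightarrow> real ^ 3" where
  "center h C = midpoint (lower h C) (upper h C)"

definition faces :: "real \<Rightarrow> cell \<Rightarrow> (real ^ 3) set set" where
  "faces h C = (\<Union>d. {{x \<in> cube h C. x $ d = lower h C $ d}, {x \<in> cube h C. x $ d = upper h C $ d}})"

text \<open>Two cells share (part of) a face if two of their faces overlap in a two-dimensional set;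
  contact along an edge or at a vertex only does not count.\<close>

definition neighbours :: "real \<Rightarrow> cell set \<Rightarrow> cell \<Rightarrow> cell set" where
  "neighbours h R C =
    {C' \<in> R. C' \<noteq> C \<and> (\<exists>F \<in> faces h C. \<exists>F' \<in> faces h C'. aff_dim (F \<inter> F') = 2)}"

definition children :: "cell \<Rightarrow> cell set" where
  "children C = {Cell (Suc (level C)) (\<chi> d. 2 * index C $ d + b $ d) | b :: nat ^ 3. \<forall>d. b $ d \<in> {0, 1}}"

text \<open>Only ever used for cells of equal level, where comparing integer positions is comparing
  coordinates.\<close>

definition lex_less :: "cell \<Rightarrow> cell \<Rightarrow> bool" where
  "lex_less C D \<longleftrightarrow> index C $ 1 < index D $ 1 \<or>
     index C $ 1 = index D $ 1 \<and> (index C $ 2 < index D $ 2 \<or>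
       index C $ 2 = index D $ 2 \<and> index C $ 3 < index D $ 3)"


section \<open>Octrees and the octree order\<close>

text \<open>\<open>N\<close> gives the number of root cells along each axis.\<close>

definition root_grid :: "nat ^ 3 \<Rightarrow> cell set" where
  "root_grid N = {Cell 0 i | i. \<forall>d. i $ d < N $ d}"

definition domain :: "real \<Rightarrow> nat ^ 3 \<Rightarrow> (real ^ 3) set" where
  "domain h N = cbox 0 (\<chi> d. real (N $ d) * h)"

inductive octree :: "nat ^ 3 \<Rightarrow> cell set \<Rightarrow> bool" for N where
  root: "octree N (root_grid N)"
| refine: "octree N R \<Longrightarrow> C \<in> R \<Longrightarrow> octree N (R - {C} \<union> children C)"

definition refine_order :: "cell set \<Rightarrow> cell \<Rightarrow> (cell \<Rightarrow> cell \<Rightarrow> bool) \<Rightarrow> cell \<Rightarrow> cell \<Rightarrow> bool" where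
  "refine_order R C prec K K' \<longleftrightarrow>
     K \<in> R - {C} \<and> K' \<in> R - {C} \<and> prec K K' \<or>
     K \<in> R - {C} \<and> K' \<in> children C \<and> prec K C \<or>
     K \<in> children C \<and> K' \<in> R - {C} \<and> prec C K' \<or>
     K \<in> children C \<and> K' \<in> children C \<and> lex_less K K'"

text \<open>\<open>octree_order N R prec\<close>: some sequence of refinements leads from the root grid to \<open>R\<close> and
  produces the order \<open>prec\<close> on \<open>R\<close>.\<close>

inductive octree_order :: "nat ^ 3 \<Rightarrow> cell set \<Rightarrow> (cell \<Rightarrow> cell \<Rightarrow> bool) \<Rightarrow> bool" for N where
  root: "octree_order N (root_grid N)
           (\<lambda>K K'. K \<in> root_grid N \<and> K' \<in> root_grid N \<and> lex_less K K')"
| refine: "octree_order N R prec \<Longrightarrow> C \<in> R \<Longrightarrow>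
           octree_order N (R - {C} \<union> children C) (refine_order R C prec)"

definition graded :: "real \<Rightarrow> cell set \<Rightarrow> bool" where
  "graded h R \<longleftrightarrow> (\<forall>C\<^sub>1 \<in> R. \<forall>C\<^sub>2 \<in> R. C\<^sub>1 \<in> neighbours h R C\<^sub>2 \<longrightarrow>
     \<bar>int (level C\<^sub>1) - int (level C\<^sub>2)\<bar> \<le> 1)"

definition uniform_refine :: "cell set \<Rightarrow> cell set" where
  "uniform_refine R = (\<Union>C \<in> R. children C)"

abbreviation refined :: "nat \<Rightarrow> cell set \<Rightarrow> cell set" where
  "refined n R \<equiv> (uniform_refine ^^ n) R"

text \<open>The components of \<open>i\<close> range over \<open>{1..2 ^ n}\<close>.\<close>

definition subcell :: "nat \<Rightarrow> cell \<Rightarrow> nat ^ 3 \<Rightarrow> cell" where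
  "subcell n C i = Cell (level C + n) (\<chi> d. 2 ^ n * index C $ d + (i $ d - 1))"


section \<open>The finite volume matrix\<close>

definition C1_on :: "(real ^ 3) set \<Rightarrow> (real ^ 3 \<Rightarrow> real) \<Rightarrow> bool" where
  "C1_on S f \<longleftrightarrow> (\<exists>g. continuous_on S g \<and>
     (\<forall>x \<in> S. (f has_derivative (\<lambda>v. g x \<bullet> v)) (at x within S)))"

definition boundary_faces :: "real \<Rightarrow> nat ^ 3 \<Rightarrow> cell \<Rightarrow> nat" where
  "boundary_faces h N C = card {F \<in> faces h C. F \<subseteq> frontier (domain h N)}"

text \<open>The factor 3 times \<open>\<alpha> = 2/3\<close> is kept as in the derivation of the scheme. The third
  case is the second one with the roles of the cells exchanged; the last one does not
  occur in a graded octree.\<close>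

definition coupling :: "real \<Rightarrow> (real ^ 3 \<Rightarrow> real) \<Rightarrow> cell \<Rightarrow> cell \<Rightarrow> real" where
  "coupling h \<sigma> C\<^sub>1 C\<^sub>2 =
    (let s\<^sub>1 = \<sigma> (center h C\<^sub>1); s\<^sub>2 = \<sigma> (center h C\<^sub>2); \<alpha> = 2 / 3 in
     if level C\<^sub>1 = level C\<^sub>2 then - 2 * edge h C\<^sub>1 * inverse (inverse s\<^sub>1 + inverse s\<^sub>2)
     else if level C\<^sub>1 = level C\<^sub>2 + 1
       then - 3 * \<alpha> * edge h C\<^sub>1 * inverse (inverse s\<^sub>1 + 2 * inverse s\<^sub>2)
     else if level C\<^sub>2 = level C\<^sub>1 + 1
       then - 3 * \<alpha> * edge h C\<^sub>2 * inverse (inverse s\<^sub>2 + 2 * inverse s\<^sub>1)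
     else 0)"

definition fv_matrix ::
  "real \<Rightarrow> nat ^ 3 \<Rightarrow> (real ^ 3 \<Rightarrow> real) \<Rightarrow> cell set \<Rightarrow> cell \<Rightarrow> cell \<Rightarrow> real" where
  "fv_matrix h N \<sigma> R C\<^sub>1 C\<^sub>2 =
    (if C\<^sub>1 = C\<^sub>2 then
       - (\<Sum>C' \<in> neighbours h R C\<^sub>1. coupling h \<sigma> C\<^sub>1 C')
       + 2 * edge h C\<^sub>1 * real (boundary_faces h N C\<^sub>1) * \<sigma> (center h C\<^sub>1)
     else if C\<^sub>2 \<in> neighbours h R C\<^sub>1 then coupling h \<sigma> C\<^sub>1 C\<^sub>2
     else 0)"


section \<open>MILU pivots and the localized estimator of condition number\<close>

definition preceding :: "real \<Rightarrow> cell set \<Rightarrow> (cell \<Rightarrow> cell \<Rightarrow> bool) \<Rightarrow> cell \<Rightarrow> cell set" where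
  "preceding h R prec K = {K' \<in> neighbours h R K. prec K' K}"

definition succeeding :: "real \<Rightarrow> cell set \<Rightarrow> (cell \<Rightarrow> cell \<Rightarrow> bool) \<Rightarrow> cell \<Rightarrow> cell set" where
  "succeeding h R prec K = {K' \<in> neighbours h R K. prec K K'}"

text \<open>Well-founded recursion along \<open>prec\<close>; the recursion equation is \<open>milu_pivot_rec\<close> below.\<close>

definition milu_pivot :: "real \<Rightarrow> cell set \<Rightarrow> (cell \<Rightarrow> cell \<Rightarrow> bool) \<Rightarrow>
    (cell \<Rightarrow> cell \<Rightarrow> real) \<Rightarrow> cell \<Rightarrow> real" where
  "milu_pivot h R prec A =
    wfrec {(K\<^sub>1, K). K\<^sub>1 \<in> R \<and> K \<in> R \<and> prec K\<^sub>1 K}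
      (\<lambda>e K. A K K - (\<Sum>K\<^sub>1 \<in> preceding h R prec K. \<Sum>K\<^sub>2 \<in> succeeding h R prec K\<^sub>1.
                A K K\<^sub>1 * A K\<^sub>1 K\<^sub>2 / e K\<^sub>1))"

definition lecn :: "real \<Rightarrow> cell set \<Rightarrow> (cell \<Rightarrow> cell \<Rightarrow> bool) \<Rightarrow>
    (cell \<Rightarrow> cell \<Rightarrow> real) \<Rightarrow> cell \<Rightarrow> real" where
  "lecn h R prec A K =
    milu_pivot h R prec A K /
      (milu_pivot h R prec A K + (\<Sum>K\<^sub>1 \<in> succeeding h R prec K. A K K\<^sub>1))"


section \<open>Well-definedness\<close>

lemma finite_index_box: "finite {i :: nat ^ 3. \<forall>d. i $ d < N $ d}"
proof -
  have "{i :: nat ^ 3. \<forall>d. i $ d < N $ d} \<subseteq> (\<lambda>f. \<chi> d. f d) ` (PiE UNIV (\<lambda>d. {..< N $ d}))"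
  proof
    fix i assume "i \<in> {i :: nat ^ 3. \<forall>d. i $ d < N $ d}"
    then show "i \<in> (\<lambda>f. \<chi> d. f d) ` (PiE UNIV (\<lambda>d. {..< N $ d}))"
      by (intro image_eqI[where x = "\<lambda>d. i $ d"]) auto
  qed
  then show ?thesis
    by (rule finite_subset) (intro finite_imageI finite_PiE, auto)
qed

lemma finite_root_grid: "finite (root_grid N)"
proof -
  have "root_grid N = Cell 0 ` {i. \<forall>d. i $ d < N $ d}"
    by (auto simp: root_grid_def)
  then show ?thesis by (simp add: finite_index_box)
qed

lemma finite_children: "finite (children C)"
proof -
  have "children C \<subseteq> (\<lambda>b. Cell (Suc (level C)) (\<chi> d. 2 * index C $ d + b $ d)) `
      {b. \<forall>d. b $ d < (\<chi> d. 2) $ d}"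
    by (auto simp: children_def intro!: imageI)
       (metis One_nat_def less_2_cases_iff)
  then show ?thesis
    by (rule finite_subset) (intro finite_imageI finite_index_box)
qed

lemma lex_less_irrefl: "\<not> lex_less K K"
  by (simp add: lex_less_def)

lemma lex_less_trans: "lex_less K L \<Longrightarrow> lex_less L M \<Longrightarrow> lex_less K M"
  by (auto simp: lex_less_def)

lemma lex_less_total: "level K = level L \<Longrightarrow> K \<noteq> L \<Longrightarrow> lex_less K L \<or> lex_less L K"
  by (cases K; cases L) (auto simp: lex_less_def vec_eq_iff forall_3)

lemma octree_order_imp_octree: "octree_order N R prec \<Longrightarrow> octree N R"
  by (induction rule: octree_order.induct) (auto intro: octree.intros)

lemma octree_order_exists: "octree N R \<Longrightarrow> \<exists>prec. octree_order N R prec"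
  by (induction rule: octree.induct) (blast intro: octree_order.intros)+

lemma finite_octree: "octree N R \<Longrightarrow> finite R"
  by (induction rule: octree.induct) (auto simp: finite_root_grid finite_children)

text \<open>\<open>overlap C D\<close>: the cells have a common descendant, i.e. \<open>i\<close> is the position of a cell
  that is reached from \<open>C\<close> by \<open>m\<close> and from \<open>D\<close> by \<open>n\<close> subdivisions. This does not happen for
  distinct cells of an octree, so that a child of a cell of an octree is a new cell.\<close>

definition overlap :: "cell \<Rightarrow> cell \<Rightarrow> bool" where
  "overlap C D \<longleftrightarrow> (\<exists>m n i. level C + m = level D + n \<and>
     (\<forall>d. i $ d div 2 ^ m = index C $ d \<and> i $ d div 2 ^ n = index D $ d))"

lemma child_coords:
  assumes "K \<in> children C"
  shows "level K = Suc (level C)" "index K $ d div 2 = index C $ d"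
proof -
  obtain b where b: "\<forall>d. b $ d \<in> {0, 1}"
    "K = Cell (Suc (level C)) (\<chi> d. 2 * index C $ d + b $ d)"
    using assms by (auto simp: children_def)
  then show "level K = Suc (level C)" by simp
  show "index K $ d div 2 = index C $ d"
    using b(1)[rule_format, of d] by (auto simp: b(2))
qed

lemma overlap_child:
  assumes "K \<in> children C" "overlap K D"
  shows "overlap C D"
proof -
  from assms(2) obtain m n i where i: "level K + m = level D + n"
    "\<And>d. i $ d div 2 ^ m = index K $ d" "\<And>d. i $ d div 2 ^ n = index D $ d"
    by (auto simp: overlap_def)
  have "i $ d div 2 ^ Suc m = index C $ d" for d
    using i(2)[of d] child_coords(2)[OF assms(1), of d]
    by (metis div_mult2_eq power_Suc2)
  moreover have "level C + Suc m = level D + n"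
    using i(1) child_coords(1)[OF assms(1)] by simp
  ultimately show ?thesis
    using i(3) unfolding overlap_def by blast
qed

lemma overlap_sym: "overlap C D \<Longrightarrow> overlap D C"
  unfolding overlap_def by metis

lemma overlap_same_level:
  assumes "overlap C D" "level C = level D"
  shows "C = D"
proof -
  have "index C $ d = index D $ d" for d
    using assms unfolding overlap_def by (metis add_left_cancel)
  then show ?thesis
    using assms(2) by (simp add: cell.expand vec_eq_iff)
qed

lemma overlap_refl: "overlap C C"
  unfolding overlap_def by (rule exI[of _ 0], rule exI[of _ 0]) auto

lemma octree_no_overlap:
  "octree N R \<Longrightarrow> C \<in> R \<Longrightarrow> D \<in> R \<Longrightarrow> overlap C D \<Longrightarrow> C = D"
proof (induction arbitrary: C D rule: octree.induct)
  case root
  then have "level C = level D" by (auto simp: root_grid_def)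
  then show ?case using overlap_same_level root by blast
next
  case (refine R B)
  have parent: "overlap X Y" if "K \<in> children X" "overlap K Y" for K X Y
    using overlap_child that by blast
  consider "C \<in> R - {B}" "D \<in> R - {B}" | "C \<in> R - {B}" "D \<in> children B"
    | "C \<in> children B" "D \<in> R - {B}" | "C \<in> children B" "D \<in> children B"
    using refine.prems by blast
  then show ?case
  proof cases
    case 1 then show ?thesis using refine by blast
  next
    case 2
    then have "overlap B C" using parent overlap_sym refine.prems by blast
    then show ?thesis using refine.IH[of B C] refine.hyps 2 by blast
  next
    case 3
    then have "overlap B D" using parent refine.prems by blast
    then show ?thesis using refine.IH[of B D] refine.hyps 3 by blast
  next
    case 4
    then show ?thesis
      using overlap_same_level refine.prems child_coords(1) by metis
  qed
qed

lemma children_notin_octree: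
  assumes "octree N R" "C \<in> R" "K \<in> children C"
  shows "K \<notin> R"
proof
  assume "K \<in> R"
  have "overlap C K" using overlap_child[OF assms(3) overlap_refl] .
  then have "C = K" using octree_no_overlap assms \<open>K \<in> R\<close> by blast
  then show False using child_coords(1)[OF assms(3)] by simp
qed

text \<open>The octree order is a strict linear order on the octree.\<close>

lemma octree_order_linear:
  assumes "octree_order N R prec"
  shows "(\<forall>K L. prec K L \<longrightarrow> K \<in> R \<and> L \<in> R) \<and> (\<forall>K. \<not> prec K K) \<and>
    (\<forall>K L M. prec K L \<longrightarrow> prec L M \<longrightarrow> prec K M) \<and>
    (\<forall>K \<in> R. \<forall>L \<in> R. K \<noteq> L \<longrightarrow> prec K L \<or> prec L K)"
  using assms
proof (induction rule: octree_order.induct)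
  case root
  have "lex_less K L \<or> lex_less L K" if "K \<in> root_grid N" "L \<in> root_grid N" "K \<noteq> L" for K L
    using that by (intro lex_less_total) (auto simp: root_grid_def)
  then show ?case using lex_less_irrefl lex_less_trans by blast
next
  case (refine R prec C)
  have new: "K \<notin> R" if "K \<in> children C" for K
    using children_notin_octree octree_order_imp_octree refine.hyps that by blast
  have tot: "lex_less K L \<or> lex_less L K" if "K \<in> children C" "L \<in> children C" "K \<noteq> L" for K L
    using that by (intro lex_less_total) (simp_all add: child_coords(1))
  note IH = refine.IH[THEN conjunct1] refine.IH[THEN conjunct2, THEN conjunct1]
    refine.IH[THEN conjunct2, THEN conjunct2, THEN conjunct1]
    refine.IH[THEN conjunct2, THEN conjunct2, THEN conjunct2]
  have in_R: "prec K L \<Longrightarrow> K \<in> R \<and> L \<in> R" and irr: "\<not> prec K K"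
    and tr: "prec K L \<Longrightarrow> prec L M \<Longrightarrow> prec K M"
    and to: "K \<in> R \<Longrightarrow> L \<in> R \<Longrightarrow> K \<noteq> L \<Longrightarrow> prec K L \<or> prec L K" for K L M
    by (use IH(1) in metis, use IH(2) in metis, use IH(3) in metis, use IH(4) in metis)
  let ?p = "refine_order R C prec" and ?Q = "R - {C} \<union> children C"
  define \<rho> where "\<rho> = (\<lambda>K. if K \<in> children C then C else K)"
  have p_iff: "?p K L \<longleftrightarrow> K \<in> ?Q \<and> L \<in> ?Q \<and>
      (prec (\<rho> K) (\<rho> L) \<or> K \<in> children C \<and> L \<in> children C \<and> lex_less K L)" for K L
    using irr[of C] new[of K] new[of L] unfolding refine_order_def \<rho>_def
    by (cases "K \<in> children C"; cases "L \<in> children C") simp_all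
  have "?p K M" if "?p K L" "?p L M" for K L M
  proof -
    have "\<rho> X = \<rho> Y" if "X \<in> children C" "Y \<in> children C" for X Y
      using that by (simp add: \<rho>_def)
    then show ?thesis
      using that tr[of "\<rho> K" "\<rho> L" "\<rho> M"] lex_less_trans[of K L M] unfolding p_iff by metis
  qed
  moreover have "?p K L \<or> ?p L K" if "K \<in> ?Q" "L \<in> ?Q" "K \<noteq> L" for K L
  proof (cases "K \<in> children C \<and> L \<in> children C")
    case True
    then show ?thesis using tot[of K L] that unfolding p_iff by blast
  next
    case False
    then have "\<rho> K \<in> R" "\<rho> L \<in> R" "\<rho> K \<noteq> \<rho> L"
      using that refine.hyps(2) by (auto simp: \<rho>_def)
    then show ?thesis using to that unfolding p_iff by blast
  qed
  moreover have "\<not> ?p K K" for K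
    using irr lex_less_irrefl unfolding p_iff by blast
  moreover have "K \<in> ?Q \<and> L \<in> ?Q" if "?p K L" for K L
    using that unfolding p_iff by blast
  ultimately show ?case by (intro conjI allI ballI impI) metis+
qed

lemma octree_order_wf:
  assumes "octree_order N R prec"
  shows "wf {(K\<^sub>1, K). K\<^sub>1 \<in> R \<and> K \<in> R \<and> prec K\<^sub>1 K}" (is "wf ?r")
proof (rule finite_acyclic_wf)
  have "?r \<subseteq> R \<times> R" by auto
  then show "finite ?r"
    using finite_octree[OF octree_order_imp_octree[OF assms]] finite_subset by blast
  have "trans ?r" "irrefl ?r"
    using octree_order_linear[OF assms] unfolding trans_def irrefl_def by blast+
  then show "acyclic ?r" by (simp add: acyclic_irrefl)
qed

lemma milu_pivot_rec:
  assumes "octree_order N R prec" "K \<in> R"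
  shows "milu_pivot h R prec A K = A K K -
    (\<Sum>K\<^sub>1 \<in> preceding h R prec K. \<Sum>K\<^sub>2 \<in> succeeding h R prec K\<^sub>1.
       A K K\<^sub>1 * A K\<^sub>1 K\<^sub>2 / milu_pivot h R prec A K\<^sub>1)"
proof -
  have eq: "milu_pivot h R prec A = wfrec {(K\<^sub>1, K). K\<^sub>1 \<in> R \<and> K \<in> R \<and> prec K\<^sub>1 K}
      (\<lambda>e K. A K K - (\<Sum>K\<^sub>1 \<in> preceding h R prec K. \<Sum>K\<^sub>2 \<in> succeeding h R prec K\<^sub>1.
                A K K\<^sub>1 * A K\<^sub>1 K\<^sub>2 / e K\<^sub>1))"
    by (rule milu_pivot_def)
  have "K\<^sub>1 \<in> R \<and> prec K\<^sub>1 K" if "K\<^sub>1 \<in> preceding h R prec K" for K\<^sub>1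
    using that by (simp add: preceding_def neighbours_def)
  then show ?thesis
    using assms(2) def_wfrec[OF eq[THEN eq_reflection] octree_order_wf[OF assms(1)], of K]
    by (simp add: cut_apply cong: sum.cong)
qed

text \<open>Uniform refinements are octrees, hence carry an octree order.\<close>

lemma octree_refine_subset:
  assumes "octree N R" "S \<subseteq> R"
  shows "octree N (R - S \<union> (\<Union>C \<in> S. children C))"
proof -
  have "finite S" using finite_octree assms finite_subset by blast
  then show ?thesis using assms(2)
  proof (induction S rule: finite_induct)
    case empty then show ?case using assms(1) by simp
  next
    case (insert C S)
    let ?Q = "R - S \<union> (\<Union>C \<in> S. children C)"
    have "C \<notin> children D" if "D \<in> S" for D
      using children_notin_octree[OF assms(1), of D C] insert.prems that by blast
    moreover have "octree N (?Q - {C} \<union> children C)"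
      using insert by (intro octree.refine) auto
    moreover have "?Q - {C} \<union> children C = R - insert C S \<union> (\<Union>C \<in> insert C S. children C)"
      using calculation(1) by auto
    ultimately show ?case by simp
  qed
qed

lemma refined_Suc: "refined (Suc n) R = (\<Union>C \<in> refined n R. children C)"
  by (simp add: uniform_refine_def [of "refined n R"])

lemma octree_refined: "octree N R \<Longrightarrow> octree N (refined n R)"
proof (induction n)
  case (Suc n)
  then show ?case
    using octree_refine_subset[of N "refined n R" "refined n R"]
    unfolding refined_Suc by simp
qed simp

lemma children_subcell:
  "children (subcell n C i) = {subcell (Suc n) C j | j. \<forall>d. j $ d \<in> {2 * (i $ d - 1) + 1, 2 * (i $ d - 1) + 2}}"
  (is "?L = ?R")
proof
  show "?L \<subseteq> ?R"
  proof
    fix K assume "K \<in> ?L"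
    then obtain b where b: "\<forall>d. b $ d \<in> {0, 1}"
      "K = Cell (Suc (level C + n)) (\<chi> d. 2 * (2 ^ n * index C $ d + (i $ d - 1)) + b $ d)"
      by (auto simp: children_def subcell_def)
    then show "K \<in> ?R"
      by (intro CollectI exI[of _ "\<chi> d. 2 * (i $ d - 1) + 1 + b $ d"])
         (auto simp: subcell_def vec_eq_iff algebra_simps)
  qed
  show "?R \<subseteq> ?L"
  proof
    fix K assume "K \<in> ?R"
    then obtain j where j: "\<forall>d. j $ d \<in> {2 * (i $ d - 1) + 1, 2 * (i $ d - 1) + 2}"
      "K = subcell (Suc n) C j" by blast
    define b :: "nat ^ 3" where "b = (\<chi> d. j $ d - 1 - 2 * (i $ d - 1))"
    have eq: "j $ d - 1 = 2 * (i $ d - 1) + b $ d" and b: "b $ d \<in> {0, 1}" for d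
      using j(1)[rule_format, of d] by (auto simp: b_def)
    have "K = Cell (Suc (level (subcell n C i))) (\<chi> d. 2 * index (subcell n C i) $ d + b $ d)"
      using eq by (simp add: j(2) subcell_def vec_eq_iff algebra_simps)
    then show "K \<in> ?L" unfolding children_def using b by blast
  qed
qed

lemma refined_eq_subcells:
  "refined n R = {subcell n C i | C i. C \<in> R \<and> (\<forall>d. i $ d \<in> {1..2 ^ n})}"
proof (induction n)
  case 0
  show ?case
  proof -
    have eq: "subcell 0 C i = C" if "\<forall>d. i $ d \<in> {1..2 ^ 0}" for C i
      using that by (cases C) (auto simp: subcell_def vec_eq_iff)
    have "\<exists>i :: nat ^ 3. \<forall>d. i $ d \<in> {1..2 ^ 0}" by (intro exI[of _ "\<chi> d. 1"]) simp
    then show ?thesis using eq by auto metis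
  qed
next
  case (Suc n)
  have "refined (Suc n) R = {subcell (Suc n) C j | C i j. C \<in> R \<and> (\<forall>d. i $ d \<in> {1..2 ^ n}) \<and>
      (\<forall>d. j $ d \<in> {2 * (i $ d - 1) + 1, 2 * (i $ d - 1) + 2})}"
  proof -
    have "refined (Suc n) R =
        {K. \<exists>C i. C \<in> R \<and> (\<forall>d. i $ d \<in> {1..2 ^ n}) \<and> K \<in> children (subcell n C i)}"
      unfolding refined_Suc Suc by blast
    then show ?thesis unfolding children_subcell by blast
  qed
  also have "\<dots> = {subcell (Suc n) C j | C j. C \<in> R \<and> (\<forall>d. j $ d \<in> {1..2 ^ Suc n})}"
  proof -
    have "(\<exists>i :: nat ^ 3. (\<forall>d. i $ d \<in> {1..2 ^ n}) \<and>
        (\<forall>d. j $ d \<in> {2 * (i $ d - 1) + 1, 2 * (i $ d - 1) + 2})) \<longleftrightarrow> (\<forall>d. j $ d \<in> {1..2 ^ Suc n})"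
      (is "?A \<longleftrightarrow> ?B") for j :: "nat ^ 3"
    proof
      assume ?A
      then obtain i :: "nat ^ 3" where i: "\<And>d. i $ d \<in> {1..2 ^ n}"
        "\<And>d. j $ d \<in> {2 * (i $ d - 1) + 1, 2 * (i $ d - 1) + 2}" by blast
      show ?B
      proof
        fix d show "j $ d \<in> {1..2 ^ Suc n}" using i(1)[of d] i(2)[of d] by auto
      qed
    next
      assume B: ?B
      have "(j $ d + 1) div 2 \<in> {1..2 ^ n} \<and>
          j $ d \<in> {2 * ((j $ d + 1) div 2 - 1) + 1, 2 * ((j $ d + 1) div 2 - 1) + 2}" for d
        using B[rule_format, of d] by auto
      then show ?A by (intro exI[of _ "\<chi> d. (j $ d + 1) div 2"]) simp
    qed
    then show ?thesis by blast
  qed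
  finally show ?case .
qed

end

theory Submission
  imports Defs
begin

text \<open>
  Let \<open>e\<close> be the MILU pivots, \<open>w\<close> the negated off-diagonal entries of the matrix, \<open>S K\<close> the sum of
  the weights \<open>w K L\<close> over the neighbours \<open>L\<close> that follow \<open>K\<close> (\<open>outflow\<close>), and \<open>d K = e K - S K\<close>
  (\<open>slack\<close>). Then the estimator is \<open>\<tau> K = 1 + S K / d K\<close>, and the recursion for the pivots becomes

    \<open>d K = B K + (\<Sum>L preceding K. w K L / \<tau> L)\<close>

  with the Dirichlet term \<open>B K\<close> of the boundary faces (lemma \<open>slack_eq\<close>). Hence if the weights to
  the following cells sum to at most \<open>1 + \<epsilon>\<close> times the sum of those to the preceding cells, and
  \<open>M\<close> bounds the estimator at the latter, then \<open>\<tau> K \<le> 1 + (1 + \<epsilon>) * M\<close>: the estimator essentially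
  counts the steps from the lower boundary of the domain. Inside a cell of the original octree the
  hypothesis on the coefficient gives \<open>\<epsilon> = \<kappa> / 2 ^ n\<close> for a constant \<open>\<kappa>\<close>; a cell is crossed in at
  most \<open>3 * 2 ^ n\<close> steps, so the relative errors accumulate to \<open>exp (3 * \<kappa>)\<close> at most.

  Where cells of different levels meet, the weights upwards can exceed those downwards by a fixed
  factor, and along an interface such a factor could build up in every step. The remedy is that one
  preceding neighbour alone already bounds the estimator, \<open>\<tau> K \<le> 1 + G * \<tau> L\<close> with a constant
  \<open>G\<close>, because all couplings of a cell are comparable and a cell has boundedly many neighbours
  (lemma \<open>estimator_jump\<close>). At the lower faces of a cell \<open>C\<close> of the original octree this is applied
  to the neighbour in an earlier cell, or the boundary of the domain takes its place; at the upper
  faces it is applied to the neighbour further inside \<open>C\<close>. So every cell of the original octree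
  costs at most four jumps, whatever \<open>n\<close> is (lemma \<open>estimator_subcell\<close>), and a well-founded
  induction along the order of the finitely many cells of the original octree gives the constant.

  The combinatorial input is that the preceding neighbours of a cell are those across its lower
  faces, for every octree order (lemmas \<open>octree_order_dominated\<close> and \<open>preceding_iff\<close>), and that
  there is such a neighbour across every lower face that is not part of the boundary of the domain
  (lemma \<open>exists_face_below\<close>).
\<close>

section \<open>Face contact in coordinates\<close>

text \<open>After translation of the corner \<open>a\<close> to the origin the box spans the same subspace as
  its pairwise orthogonal edge vectors in the nondegenerate directions.\<close>
lemma aff_dim_cbox_cart:
  fixes a b :: "real ^ 'n"
  assumes "\<And>e. a $ e \<le> b $ e"
  shows "aff_dim (cbox a b) = int (card {e. a $ e < b $ e})"
proof -
  define J where "J = {e. a $ e < b $ e}"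
  define v where "v e = axis e (b $ e - a $ e)" for e
  have v_nth: "v e $ f = (if f = e then b $ e - a $ e else 0)" for e f
    by (simp add: v_def axis_def)
  have inj: "inj_on v J"
  proof
    fix e f assume "e \<in> J" "f \<in> J" "v e = v f"
    then have "v e $ e = v f $ e" by simp
    then show "e = f" using \<open>e \<in> J\<close> by (auto simp: v_nth J_def split: if_splits)
  qed
  have "a \<in> affine hull cbox a b"
    by (intro hull_inc) (simp add: mem_box_cart assms)
  then have "aff_dim (cbox a b) = int (dim ((\<lambda>x. x - a) ` cbox a b))"
    by (rule aff_dim_eq_dim_subtract)
  also have "dim ((\<lambda>x. x - a) ` cbox a b) = card J"
  proof (rule dim_unique)
    show "v ` J \<subseteq> (\<lambda>x. x - a) ` cbox a b"
    proof safe
      fix e assume "e \<in> J"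
      have "v e + a \<in> cbox a b"
        using assms \<open>e \<in> J\<close> by (auto simp: mem_box_cart v_nth J_def)
      then show "v e \<in> (\<lambda>x. x - a) ` cbox a b"
        by (intro image_eqI[where x = "v e + a"]) simp_all
    qed
    show "(\<lambda>x. x - a) ` cbox a b \<subseteq> span (v ` J)"
    proof safe
      fix x assume x: "x \<in> cbox a b"
      have coord: "x $ f - a $ f = (\<Sum>e\<in>J. (x $ e - a $ e) / (b $ e - a $ e) * v e $ f)" for f
      proof (cases "f \<in> J")
        case True
        then have "(\<Sum>e\<in>J. (x $ e - a $ e) / (b $ e - a $ e) * v e $ f) =
            (\<Sum>e\<in>J. if e = f then x $ f - a $ f else 0)"
          by (intro sum.cong refl) (auto simp: v_nth J_def)
        then show ?thesis using True by simp
      next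
        case False
        then have "a $ f = b $ f"
          using assms[of f] by (simp add: J_def)
        moreover have "a $ f \<le> x $ f \<and> x $ f \<le> b $ f"
          using x by (simp add: mem_box_cart)
        ultimately have "x $ f = a $ f" by simp
        moreover have "(\<Sum>e\<in>J. (x $ e - a $ e) / (b $ e - a $ e) * v e $ f) = 0"
          using False by (intro sum.neutral) (auto simp: v_nth)
        ultimately show ?thesis by simp
      qed
      have "x - a = (\<Sum>e\<in>J. ((x $ e - a $ e) / (b $ e - a $ e)) *\<^sub>R v e)"
      proof (rule vec_eq_iff[THEN iffD2], rule allI)
        fix f
        show "(x - a) $ f = (\<Sum>e\<in>J. ((x $ e - a $ e) / (b $ e - a $ e)) *\<^sub>R v e) $ f"
          using coord[of f] by (simp only: sum_component vector_minus_component
              vector_scaleR_component real_scaleR_def)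
      qed
      also have "\<dots> \<in> span (v ` J)"
        by (intro span_sum span_scale span_base imageI)
      finally show "x - a \<in> span (v ` J)" .
    qed
    show "independent (v ` J)"
    proof (rule pairwise_orthogonal_independent)
      show "pairwise orthogonal (v ` J)"
        by (auto simp: pairwise_def orthogonal_def v_def inner_axis_axis)
      show "0 \<notin> v ` J"
      proof
        assume "0 \<in> v ` J"
        then obtain e where "e \<in> J" "v e = 0" by auto
        then have "v e $ e = 0" by simp
        then show False using \<open>e \<in> J\<close> by (simp add: v_nth J_def)
      qed
    qed
    show "card (v ` J) = card J" using inj by (rule card_image)
  qed
  finally show ?thesis unfolding J_def .
qed

text \<open>The intersection is a box that is degenerate in the directions \<open>d\<close> and \<open>d'\<close>. In three dimensions
  this leaves room for a two-dimensional set only if the two directions coincide and the other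
  two are nondegenerate.\<close>
lemma aff_dim_face_Int:
  fixes a b a' b' :: "real ^ 3"
  assumes "\<And>e. a $ e < b $ e" "\<And>e. a' $ e < b' $ e"
    and "a $ d \<le> s" "s \<le> b $ d" "a' $ d' \<le> s'" "s' \<le> b' $ d'"
  shows "aff_dim ({x \<in> cbox a b. x $ d = s} \<inter> {x \<in> cbox a' b'. x $ d' = s'}) = 2 \<longleftrightarrow>
    d = d' \<and> s = s' \<and> (\<forall>e. e \<noteq> d \<longrightarrow> a $ e < b' $ e \<and> a' $ e < b $ e)"
    (is "aff_dim ?F = 2 \<longleftrightarrow> ?R")
proof -
  define u where "u = (\<chi> e. max (if e = d then s else a $ e) (if e = d' then s' else a' $ e))"
  define v where "v = (\<chi> e. min (if e = d then s else b $ e) (if e = d' then s' else b' $ e))"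
  have F: "?F = cbox u v"
  proof (intro set_eqI)
    fix x
    have "x \<in> ?F \<longleftrightarrow> (\<forall>e. (a $ e \<le> x $ e \<and> x $ e \<le> b $ e) \<and> (a' $ e \<le> x $ e \<and> x $ e \<le> b' $ e) \<and>
        (e = d \<longrightarrow> x $ e = s) \<and> (e = d' \<longrightarrow> x $ e = s'))"
      by (auto simp: mem_box_cart)
    also have "\<dots> \<longleftrightarrow> (\<forall>e. u $ e \<le> x $ e \<and> x $ e \<le> v $ e)"
    proof (intro all_cong1)
      fix e
      show "(a $ e \<le> x $ e \<and> x $ e \<le> b $ e) \<and> (a' $ e \<le> x $ e \<and> x $ e \<le> b' $ e) \<and>
          (e = d \<longrightarrow> x $ e = s) \<and> (e = d' \<longrightarrow> x $ e = s') \<longleftrightarrow> u $ e \<le> x $ e \<and> x $ e \<le> v $ e"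
        using assms(3-6) by (cases "e = d"; cases "e = d'") (auto simp: u_def v_def)
    qed
    finally show "x \<in> ?F \<longleftrightarrow> x \<in> cbox u v" by (simp add: mem_box_cart)
  qed
  show ?thesis
  proof
    assume dim: "aff_dim ?F = 2"
    then have "cbox u v \<noteq> {}" using F by auto
    then have le: "u $ e \<le> v $ e" for e
      by (meson interval_ne_empty_cart(1))
    have card: "card {e. u $ e < v $ e} = 2"
      using dim aff_dim_cbox_cart[OF le] F by simp
    have "\<not> u $ d < v $ d" "\<not> u $ d' < v $ d'" by (auto simp: u_def v_def)
    then have sub: "{e. u $ e < v $ e} \<subseteq> UNIV - {d, d'}" by auto
    have card': "card (UNIV - {d, d'}) = 3 - card {d, d'}"
      by (subst card_Diff_subset) auto
    have "d = d'"
    proof (rule ccontr)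
      assume "d \<noteq> d'"
      then show False using card_mono[OF _ sub] card card' by simp
    qed
    then have eq: "{e. u $ e < v $ e} = UNIV - {d, d'}"
      using card card' by (intro card_subset_eq[OF _ sub]) simp_all
    have "s = s'" using le[of d] \<open>d = d'\<close> by (simp add: u_def v_def)
    moreover have "a $ e < b' $ e \<and> a' $ e < b $ e" if "e \<noteq> d" for e
    proof -
      have "u $ e < v $ e" using eq that \<open>d = d'\<close> by auto
      then show ?thesis using that \<open>d = d'\<close> by (simp add: u_def v_def)
    qed
    ultimately show ?R using \<open>d = d'\<close> by blast
  next
    assume R: ?R
    then have uv: "u $ e < v $ e \<longleftrightarrow> e \<noteq> d" "u $ e \<le> v $ e" for e
      using assms(1)[of e] assms(2)[of e] by (auto simp: u_def v_def less_imp_le)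
    have "card {e. u $ e < v $ e} = card (UNIV - {d})"
      by (rule arg_cong[where f = card]) (auto simp: uv(1))
    also have "\<dots> = 2" by (subst card_Diff_subset) auto
    finally show "aff_dim ?F = 2" using aff_dim_cbox_cart[OF uv(2)] F by simp
  qed
qed

text \<open>This relation is preserved when either cell is replaced by a larger one, hence it passes from
  cells to their ancestors; on a single level it compares positions componentwise. Both facts
  together imply that every octree order extends it.\<close>
definition dominated :: "real \<Rightarrow> cell \<Rightarrow> cell \<Rightarrow> bool" where
  "dominated h K L \<longleftrightarrow> (\<forall>e. lower h K $ e < upper h L $ e)"

text \<open>The strict inequalities express that the two faces in the common plane overlap in a set of
  dimension two.\<close>
definition face_below :: "real \<Rightarrow> 3 \<Rightarrow> cell \<Rightarrow> cell \<Rightarrow> bool" where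
  "face_below h d K L \<longleftrightarrow> upper h K $ d = lower h L $ d \<and>
     (\<forall>e. e \<noteq> d \<longrightarrow> lower h K $ e < upper h L $ e \<and> lower h L $ e < upper h K $ e)"

lemma edge_pos: "h > 0 \<Longrightarrow> edge h C > 0"
  by (simp add: edge_def)

lemma upper_eq: "upper h C $ e = lower h C $ e + edge h C"
  by (simp add: upper_def lower_def algebra_simps)

lemma lower_less_upper: "h > 0 \<Longrightarrow> lower h C $ e < upper h C $ e"
  by (simp add: upper_eq edge_pos)

lemma face_below_dominated:
  assumes "h > 0" "face_below h d K L"
  shows "dominated h K L"
  unfolding dominated_def
proof
  fix e show "lower h K $ e < upper h L $ e"
    using assms lower_less_upper[of h K e] lower_less_upper[of h L e]
    by (cases "e = d") (auto simp: face_below_def)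
qed

lemma faces_iff:
  "F \<in> faces h C \<longleftrightarrow> (\<exists>d s. F = {x \<in> cbox (lower h C) (upper h C). x $ d = s} \<and>
     (s = lower h C $ d \<or> s = upper h C $ d))"
  unfolding faces_def cube_def by blast

text \<open>Faces in a common plane that are both lower or both upper faces of their cells would make the
  cells overlap, which \<open>unique\<close> excludes. So an upper face of one cell meets a lower face of the
  other one.\<close>
lemma neighbours_iff:
  assumes "h > 0" and unique: "\<And>K L. K \<in> R \<Longrightarrow> L \<in> R \<Longrightarrow> dominated h K L \<Longrightarrow> dominated h L K \<Longrightarrow> K = L"
    and "K \<in> R"
  shows "L \<in> neighbours h R K \<longleftrightarrow> L \<in> R \<and> (\<exists>d. face_below h d L K \<or> face_below h d K L)"
proof
  assume "L \<in> neighbours h R K"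
  then obtain F F' where L: "L \<in> R" "L \<noteq> K" and FF: "F \<in> faces h K" "F' \<in> faces h L"
    "aff_dim (F \<inter> F') = 2"
    unfolding neighbours_def by blast
  obtain d s where F: "F = {x \<in> cbox (lower h K) (upper h K). x $ d = s}"
      and s: "s = lower h K $ d \<or> s = upper h K $ d"
    using FF(1) unfolding faces_iff by blast
  obtain d' s' where F': "F' = {x \<in> cbox (lower h L) (upper h L). x $ d' = s'}"
      and s': "s' = lower h L $ d' \<or> s' = upper h L $ d'"
    using FF(2) unfolding faces_iff by blast
  note lt = lower_less_upper[OF \<open>h > 0\<close>]
  have bounds: "lower h K $ d \<le> s" "s \<le> upper h K $ d" "lower h L $ d' \<le> s'" "s' \<le> upper h L $ d'"
    using s s' lt[of K d] lt[of L d'] by auto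
  have *: "d = d'" "s = s'"
    and tang: "\<And>e. e \<noteq> d \<Longrightarrow> lower h K $ e < upper h L $ e \<and> lower h L $ e < upper h K $ e"
    using FF(3) aff_dim_face_Int[OF lt lt bounds] unfolding F F' by auto
  have "s = lower h K $ d \<and> s = upper h L $ d \<or> s = upper h K $ d \<and> s = lower h L $ d"
  proof (rule ccontr)
    assume "\<not> ?thesis"
    then have "lower h K $ d = lower h L $ d \<or> upper h K $ d = upper h L $ d"
      using s s' * by auto
    then have "lower h K $ d < upper h L $ d \<and> lower h L $ d < upper h K $ d"
      using lt[of K d] lt[of L d] by auto
    then have "dominated h K L" "dominated h L K"
      using tang unfolding dominated_def by metis+
    then show False using unique[OF \<open>K \<in> R\<close> L(1)] L(2) by blast
  qed
  then show "L \<in> R \<and> (\<exists>d. face_below h d L K \<or> face_below h d K L)"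
    using L(1) tang unfolding face_below_def by metis
next
  assume "L \<in> R \<and> (\<exists>d. face_below h d L K \<or> face_below h d K L)"
  then obtain d where L: "L \<in> R" and d: "face_below h d L K \<or> face_below h d K L" by blast
  note lt = lower_less_upper[OF \<open>h > 0\<close>]
  obtain s where s: "s = lower h K $ d \<and> s = upper h L $ d \<or> s = upper h K $ d \<and> s = lower h L $ d"
    using d unfolding face_below_def by auto
  have tang: "\<And>e. e \<noteq> d \<Longrightarrow> lower h K $ e < upper h L $ e \<and> lower h L $ e < upper h K $ e"
    using d unfolding face_below_def by blast
  have bounds: "lower h K $ d \<le> s" "s \<le> upper h K $ d" "lower h L $ d \<le> s" "s \<le> upper h L $ d"
    using s lt[of K d] lt[of L d] by auto
  have "aff_dim ({x \<in> cbox (lower h K) (upper h K). x $ d = s} \<inter>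
      {x \<in> cbox (lower h L) (upper h L). x $ d = s}) = 2"
    using aff_dim_face_Int[OF lt lt bounds] tang by simp
  moreover have "{x \<in> cbox (lower h K) (upper h K). x $ d = s} \<in> faces h K"
      "{x \<in> cbox (lower h L) (upper h L). x $ d = s} \<in> faces h L"
    using s unfolding faces_iff by blast+
  moreover have "L \<noteq> K"
    using d lt[of K d] unfolding face_below_def by auto
  ultimately show "L \<in> neighbours h R K"
    using L unfolding neighbours_def by blast
qed

section \<open>Octree orders, coverings and boundary faces\<close>
lemma child_within:
  assumes "h > 0" "K \<in> children C"
  shows "lower h C $ e \<le> lower h K $ e" "upper h K $ e \<le> upper h C $ e"
proof -
  obtain b where b: "\<forall>d. b $ d \<in> {0, 1}"
    "K = Cell (Suc (level C)) (\<chi> d. 2 * index C $ d + b $ d)"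
    using assms(2) by (auto simp: children_def)
  have "b $ e = 0 \<or> b $ e = 1" using b(1) by auto
  then show "lower h C $ e \<le> lower h K $ e" "upper h K $ e \<le> upper h C $ e"
    using assms(1) by (auto simp: lower_def upper_def edge_def b(2) field_simps)
qed

lemma dominated_same_level:
  assumes "h > 0" "level K = level L" "dominated h K L"
  shows "index K $ e \<le> index L $ e"
proof -
  have "real (index K $ e) * edge h K < (real (index L $ e) + 1) * edge h K"
    using assms by (simp add: dominated_def lower_def upper_def edge_def)
  then have "real (index K $ e) < real (index L $ e) + 1"
    using edge_pos[OF assms(1), of K] by (simp only: mult_less_cancel_right_pos)
  then show ?thesis by linarith
qed

lemma dominated_same_level_lex:
  assumes "h > 0" "level K = level L" "dominated h K L" "K \<noteq> L"
  shows "lex_less K L"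
  using lex_less_total[OF assms(2,4)] dominated_same_level[OF assms(1-3), of 1]
    dominated_same_level[OF assms(1-3), of 2] dominated_same_level[OF assms(1-3), of 3]
  by (auto simp: lex_less_def)

text \<open>When a cell is refined, domination by or of one of its children implies domination by or of the
  cell itself, so that the order of the coarser octree decides; siblings are compared
  lexicographically, and domination means componentwise comparison for them. This lemma is all
  that is used about the octree order besides its being a well-founded strict order.\<close>
lemma octree_order_dominated:
  assumes "octree_order N R prec" "h > 0"
  shows "K \<in> R \<Longrightarrow> L \<in> R \<Longrightarrow> dominated h K L \<Longrightarrow> K \<noteq> L \<Longrightarrow> prec K L"
  using assms(1)
proof (induction arbitrary: K L rule: octree_order.induct)
  case root
  then have "level K = level L" by (auto simp: root_grid_def)
  then show ?case
    using dominated_same_level_lex[OF assms(2)] root by blast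
next
  case (refine R prec C)
  have left: "dominated h C M" if "X \<in> children C" "dominated h X M" for X M
    using that child_within(1)[OF assms(2)] unfolding dominated_def by (meson order_le_less_trans)
  have right: "dominated h M C" if "X \<in> children C" "dominated h M X" for X M
    using that child_within(2)[OF assms(2)] unfolding dominated_def by (meson order_less_le_trans)
  consider "K \<in> R - {C}" "L \<in> R - {C}" | "K \<in> R - {C}" "L \<in> children C"
    | "K \<in> children C" "L \<in> R - {C}" | "K \<in> children C" "L \<in> children C"
    using refine.prems by blast
  then show ?case
  proof cases
    case 1
    then show ?thesis using refine.IH[of K L] refine.prems unfolding refine_order_def by blast
  next
    case 2
    then show ?thesis
      using refine.IH[of K C] refine.prems refine.hyps(2) right[of L K]
      unfolding refine_order_def by blast
  next
    case 3
    then show ?thesis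
      using refine.IH[of C L] refine.prems refine.hyps(2) left[of K L]
      unfolding refine_order_def by blast
  next
    case 4
    then have "lex_less K L"
      using dominated_same_level_lex[OF assms(2) _ refine.prems(3,4)] by (simp add: child_coords(1))
    then show ?thesis using 4 unfolding refine_order_def by blast
  qed
qed

text \<open>Half-open cells are used because the children of a half-open cell again partition it.\<close>
lemma octree_covers:
  assumes "octree N R" "h > 0" "\<And>e. 0 \<le> p $ e" "\<And>e. p $ e < real (N $ e) * h"
  shows "\<exists>C \<in> R. \<forall>e. lower h C $ e \<le> p $ e \<and> p $ e < upper h C $ e"
  using assms(1)
proof induction
  case root
  define i :: "nat ^ 3" where "i = (\<chi> e. nat \<lfloor>p $ e / h\<rfloor>)"
  have i: "real (i $ e) = of_int \<lfloor>p $ e / h\<rfloor>" for e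
    using assms(2,3) by (simp add: i_def)
  have "lower h (Cell 0 i) $ e \<le> p $ e \<and> p $ e < upper h (Cell 0 i) $ e" for e
  proof -
    have "of_int \<lfloor>p $ e / h\<rfloor> \<le> p $ e / h" "p $ e / h < of_int \<lfloor>p $ e / h\<rfloor> + 1"
      by linarith+
    then have "of_int \<lfloor>p $ e / h\<rfloor> * h \<le> p $ e" "p $ e < (of_int \<lfloor>p $ e / h\<rfloor> + 1) * h"
      using assms(2) by (simp_all only: pos_le_divide_eq pos_divide_less_eq)
    then show ?thesis
      by (simp add: lower_def upper_def edge_def i)
  qed
  moreover have "i $ e < N $ e" for e
  proof -
    have "real (i $ e) \<le> p $ e / h" unfolding i by linarith
    also have "\<dots> < real (N $ e)" using assms(2,4) by (simp add: field_simps)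
    finally show ?thesis by simp
  qed
  ultimately show ?case unfolding root_grid_def by blast
next
  case (refine R C)
  then obtain D where D: "D \<in> R" "\<And>e. lower h D $ e \<le> p $ e" "\<And>e. p $ e < upper h D $ e"
    by blast
  show ?case
  proof (cases "D = C")
    case False
    then show ?thesis using D by blast
  next
    case True
    define b :: "nat ^ 3" where "b = (\<chi> e. if p $ e < lower h C $ e + edge h C / 2 then 0 else 1)"
    define K where "K = Cell (Suc (level C)) (\<chi> d. 2 * index C $ d + b $ d)"
    have "K \<in> children C" unfolding children_def K_def mem_Collect_eq
      by (intro exI[of _ b]) (simp add: b_def)
    moreover have "lower h K $ e \<le> p $ e \<and> p $ e < upper h K $ e" for e
    proof -
      have "edge h K = edge h C / 2" by (simp add: edge_def K_def)
      moreover have "lower h K $ e = lower h C $ e + real (b $ e) * (edge h C / 2)"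
        by (simp add: lower_def K_def edge_def field_simps)
      ultimately show ?thesis
        using D(2,3)[of e] True by (auto simp: upper_eq b_def)
    qed
    ultimately show ?thesis by blast
  qed
qed

lemma octree_in_domain:
  assumes "octree N R" "h > 0" "K \<in> R"
  shows "0 \<le> lower h K $ e" "upper h K $ e \<le> real (N $ e) * h"
proof -
  show "0 \<le> lower h K $ e" using assms(2) by (simp add: lower_def edge_def)
  show "upper h K $ e \<le> real (N $ e) * h"
    using assms(1,3)
  proof (induction arbitrary: K)
    case root
    then obtain i where i: "K = Cell 0 i" "i $ e < N $ e" by (auto simp: root_grid_def)
    then have "real (i $ e) + 1 \<le> real (N $ e)" by simp
    then have "(real (i $ e) + 1) * h \<le> real (N $ e) * h"
      using assms(2) by (intro mult_right_mono) simp_all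
    then show ?case by (simp add: upper_def edge_def i(1))
  next
    case (refine R C)
    then show ?case using child_within(2)[OF assms(2)] by (meson DiffE UnE order_trans)
  qed
qed

lemma center_in_domain:
  assumes "octree N R" "h > 0" "K \<in> R"
  shows "center h K \<in> domain h N"
proof -
  have "0 \<le> (lower h K $ e + upper h K $ e) / 2 \<and> (lower h K $ e + upper h K $ e) / 2 \<le> real (N $ e) * h" for e
    using octree_in_domain[OF assms, of e] lower_less_upper[OF assms(2), of K e] by simp
  then show ?thesis
    by (simp add: domain_def mem_box_cart center_def midpoint_def)
qed

lemma lower_subcell:
  "lower h (subcell n C i) $ e = lower h C $ e + real (i $ e - 1) * (edge h C / 2 ^ n)"
  by (simp add: lower_def subcell_def edge_def field_simps power_add)

lemma edge_subcell: "edge h (subcell n C i) = edge h C / 2 ^ n"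
  by (simp add: subcell_def edge_def power_add)

lemma subcell_within:
  assumes "h > 0" "i $ e \<in> {1..2 ^ n}"
  shows "lower h C $ e \<le> lower h (subcell n C i) $ e" "upper h (subcell n C i) $ e \<le> upper h C $ e"
proof -
  have ed: "0 < edge h C / 2 ^ n" using edge_pos[OF assms(1)] by simp
  show "lower h C $ e \<le> lower h (subcell n C i) $ e"
    using mult_nonneg_nonneg[OF of_nat_0_le_iff less_imp_le[OF ed]]
    by (simp only: lower_subcell le_add_same_cancel1)
  have "real (i $ e - 1) + 1 \<le> 2 ^ n"
  proof -
    have "i $ e - 1 + 1 \<le> 2 ^ n" using assms(2) by simp
    then have "real (i $ e - 1 + 1) \<le> real (2 ^ n)" by (rule of_nat_mono)
    then show ?thesis by simp
  qed
  then have "(real (i $ e - 1) + 1) * (edge h C / 2 ^ n) \<le> 2 ^ n * (edge h C / 2 ^ n)"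
    using ed by (intro mult_right_mono) simp_all
  also have "\<dots> = edge h C" by simp
  finally show "upper h (subcell n C i) $ e \<le> upper h C $ e"
    by (simp only: upper_eq lower_subcell edge_subcell distrib_right mult_1_left add.assoc
        add_le_cancel_left)
qed

locale ordered_octree =
  fixes h :: real and N :: "nat ^ 3" and R :: "cell set" and prec :: "cell \<Rightarrow> cell \<Rightarrow> bool"
  assumes h_pos: "h > 0" and order: "octree_order N R prec"
begin

lemmas octree = octree_order_imp_octree[OF order]
lemmas finite_cells = finite_octree[OF octree]
lemmas lower_lt_upper = lower_less_upper[OF h_pos]

lemma prec_irrefl: "\<not> prec K K"
  and prec_trans: "prec K L \<Longrightarrow> prec L M \<Longrightarrow> prec K M"
  using octree_order_linear[OF order] by blast+

lemma dominated_prec: "K \<in> R \<Longrightarrow> L \<in> R \<Longrightarrow> dominated h K L \<Longrightarrow> K \<noteq> L \<Longrightarrow> prec K L"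
  by (rule octree_order_dominated[OF order h_pos])

text \<open>Cells that dominate each other would precede each other.\<close>
lemma dominated_antisym:
  assumes "K \<in> R" "L \<in> R" "dominated h K L" "dominated h L K"
  shows "K = L"
  using assms dominated_prec prec_trans prec_irrefl by metis

lemma neighbours_iff_face_below:
  "K \<in> R \<Longrightarrow> L \<in> neighbours h R K \<longleftrightarrow> L \<in> R \<and> (\<exists>d. face_below h d L K \<or> face_below h d K L)"
  using neighbours_iff[OF h_pos dominated_antisym] by blast

lemma face_below_neq: "face_below h d K L \<Longrightarrow> K \<noteq> L"
  using lower_lt_upper[of K d] by (auto simp: face_below_def)

lemma face_below_prec: "K \<in> R \<Longrightarrow> L \<in> R \<Longrightarrow> face_below h d K L \<Longrightarrow> prec K L"
  using dominated_prec face_below_dominated[OF h_pos] face_below_neq by blast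

lemma neighbours_sym: "K \<in> R \<Longrightarrow> L \<in> neighbours h R K \<Longrightarrow> K \<in> neighbours h R L"
  using neighbours_iff_face_below[of K L] neighbours_iff_face_below[of L K] by blast

text \<open>The order refers to a history of refinements, but it does not influence which neighbours precede
  a cell: these are the neighbours across its three lower faces.\<close>
lemma preceding_iff:
  assumes "K \<in> R"
  shows "L \<in> preceding h R prec K \<longleftrightarrow> L \<in> R \<and> (\<exists>d. face_below h d L K)"
  unfolding preceding_def mem_Collect_eq neighbours_iff_face_below[OF assms]
  using assms face_below_prec prec_trans prec_irrefl by metis

lemma succeeding_iff:
  assumes "K \<in> R"
  shows "L \<in> succeeding h R prec K \<longleftrightarrow> L \<in> R \<and> (\<exists>d. face_below h d K L)"
  unfolding succeeding_def mem_Collect_eq neighbours_iff_face_below[OF assms]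
  using assms face_below_prec prec_trans prec_irrefl by metis

lemma neighbours_eq:
  assumes "K \<in> R"
  shows "neighbours h R K = preceding h R prec K \<union> succeeding h R prec K"
    "preceding h R prec K \<inter> succeeding h R prec K = {}"
proof -
  show "neighbours h R K = preceding h R prec K \<union> succeeding h R prec K"
    by (intro set_eqI)
      (auto simp: neighbours_iff_face_below[OF assms] preceding_iff[OF assms] succeeding_iff[OF assms])
  show "preceding h R prec K \<inter> succeeding h R prec K = {}"
  proof (intro equals0I)
    fix L assume "L \<in> preceding h R prec K \<inter> succeeding h R prec K"
    then have "prec L K" "prec K L" by (simp_all add: preceding_def succeeding_def)
    then show False using prec_trans[of L K L] prec_irrefl by blast
  qed
qed

lemma finite_neighbours: "finite (neighbours h R K)"
  using finite_cells by (rule rev_finite_subset) (auto simp: neighbours_def)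

text \<open>The witness is the cell that contains a point \<open>p\<close> just below the lower corner of \<open>K\<close> in
  direction \<open>d\<close>.\<close>
lemma exists_face_below:
  assumes "K \<in> R" "lower h K $ d > 0"
  shows "\<exists>L \<in> R. face_below h d L K"
proof -
  \<comment> \<open>No cell ends strictly between the height \<open>v\<close> and the lower face of \<open>K\<close>. A cell that contains a
    point at height \<open>v\<close> therefore reaches that face.\<close>
  define V where "V = insert 0 {upper h L $ d | L. L \<in> R \<and> upper h L $ d < lower h K $ d}"
  define v where "v = Max V"
  have "V \<subseteq> insert 0 ((\<lambda>L. upper h L $ d) ` R)" by (auto simp: V_def)
  then have fin: "finite V" using finite_cells finite_subset by blast
  have "v \<in> V" unfolding v_def using fin by (intro Max_in) (auto simp: V_def)
  then have v_less: "v < lower h K $ d" using assms(2) by (auto simp: V_def)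
  have v_nonneg: "0 \<le> v" unfolding v_def using fin by (intro Max_ge) (auto simp: V_def)
  have v_max: "upper h L $ d \<le> v" if "L \<in> R" "upper h L $ d < lower h K $ d" for L
    unfolding v_def using fin that by (intro Max_ge) (auto simp: V_def)
  define p where "p = (\<chi> e. if e = d then v else lower h K $ e)"
  have p_less: "p $ e < upper h K $ e" for e
    using v_less lower_lt_upper[of K e] by (auto simp: p_def)
  have "0 \<le> p $ e" for e
    using v_nonneg octree_in_domain(1)[OF octree h_pos assms(1)] by (simp add: p_def)
  moreover have "p $ e < real (N $ e) * h" for e
    using p_less[of e] octree_in_domain(2)[OF octree h_pos assms(1), of e] by simp
  ultimately obtain L where L: "L \<in> R" "\<And>e. lower h L $ e \<le> p $ e" "\<And>e. p $ e < upper h L $ e"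
    using octree_covers[OF octree h_pos, of p] by blast
  have ge: "upper h L $ d \<ge> lower h K $ d"
    using v_max[OF L(1)] L(3)[of d] by (force simp: p_def)
  have "L \<noteq> K" using L(2)[of d] v_less by (auto simp: p_def)
  have dom: "dominated h L K"
    unfolding dominated_def using L(2) p_less order_le_less_trans by blast
  \<comment> \<open>\<open>L\<close> does not extend beyond the face either, for then it would overlap \<open>K\<close>.\<close>
  have "\<not> dominated h K L" using dominated_antisym dom assms(1) L(1) \<open>L \<noteq> K\<close> by blast
  then obtain e where e: "upper h L $ e \<le> lower h K $ e" unfolding dominated_def by (auto simp: not_less)
  have tang: "lower h K $ f < upper h L $ f" if "f \<noteq> d" for f
    using L(3)[of f] that by (simp add: p_def)
  have "e = d" using tang e by force
  then have "upper h L $ d = lower h K $ d" using e ge by simp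
  then have "face_below h d L K"
    using tang dom unfolding face_below_def dominated_def by blast
  then show ?thesis using L(1) by blast
qed

lemma boundary_faces_pos:
  assumes "K \<in> R" "lower h K $ d = 0"
  shows "boundary_faces h N K \<ge> 1"
proof -
  let ?F = "{x \<in> cube h K. x $ d = lower h K $ d}"
  have "?F \<subseteq> frontier (domain h N)"
  proof
    fix x assume x: "x \<in> ?F"
    have "lower h K $ e \<le> x $ e \<and> x $ e \<le> upper h K $ e" for e
      using x by (simp add: cube_def mem_box_cart)
    then have "0 \<le> x $ e \<and> x $ e \<le> real (N $ e) * h" for e
      using octree_in_domain[OF octree h_pos assms(1), of e] by (meson order_trans)
    then have "x \<in> domain h N" by (simp add: domain_def mem_box_cart)
    moreover have "x \<notin> box 0 (\<chi> d. real (N $ d) * h)"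
      using x assms(2) by (auto simp: mem_box_cart intro!: exI[of _ d])
    ultimately show "x \<in> frontier (domain h N)"
      by (simp add: domain_def frontier_cbox)
  qed
  moreover have "?F \<in> faces h K" unfolding faces_def by blast
  moreover have "finite (faces h K)" unfolding faces_def by simp
  ultimately have "card {?F} \<le> boundary_faces h N K"
    unfolding boundary_faces_def by (intro card_mono) auto
  then show ?thesis by simp
qed

end

section \<open>The MILU recursion for the row-sum excess\<close>

definition weight :: "real \<Rightarrow> (real ^ 3 \<Rightarrow> real) \<Rightarrow> cell \<Rightarrow> cell \<Rightarrow> real" where
  "weight h \<sigma> K L = - coupling h \<sigma> K L"

text \<open>In a graded octree a neighbour is determined by its level relative to the cell and by the offset
  of its position from a base point. There are three relative levels, and since a cell
  touches at most four positions per direction, offsets below four are enough.\<close>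
definition neighbour_bound :: nat where
  "neighbour_bound = card ({..2 :: nat} \<times> {i :: nat ^ 3. \<forall>d. i $ d < (\<chi> d. 4) $ d})"

text \<open>This bounds the quotient of the sum of all couplings of a cell to later cells and any single
  coupling of that cell.\<close>
definition jump_factor :: "real \<Rightarrow> real" where
  "jump_factor q = 2 * real neighbour_bound * (1 + 2 * q)"

lemma jump_factor_nonneg: "1 \<le> q \<Longrightarrow> 0 \<le> jump_factor q"
  by (simp add: jump_factor_def)

lemma inverse_between:
  fixes a q D :: real
  assumes "0 < a" "0 < q" "inverse a \<le> D" "D \<le> q * inverse a"
  shows "a / q \<le> inverse D" "inverse D \<le> a"
proof -
  have "0 < D" using assms(1,3) by (meson less_le_trans positive_imp_inverse_positive)
  show "inverse D \<le> a"
    using le_imp_inverse_le[OF assms(3)] assms(1) by simp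
  show "a / q \<le> inverse D"
    using le_imp_inverse_le[OF assms(4) \<open>0 < D\<close>] assms(1,2) by (simp add: field_simps)
qed

text \<open>The number \<open>q\<close> bounds the quotient of the coefficients of neighbouring cells.\<close>
locale fv_octree = ordered_octree +
  fixes \<sigma> :: "real ^ 3 \<Rightarrow> real" and q :: real
  assumes graded: "graded h R"
    and \<sigma>_pos: "K \<in> R \<Longrightarrow> 0 < \<sigma> (center h K)"
    and \<sigma>_ratio: "K \<in> R \<Longrightarrow> L \<in> neighbours h R K \<Longrightarrow> \<sigma> (center h K) \<le> q * \<sigma> (center h L)"
    and q_ge_1: "1 \<le> q"
begin

abbreviation "A \<equiv> fv_matrix h N \<sigma> R"
abbreviation "pivot \<equiv> milu_pivot h R prec A"
abbreviation "\<tau> \<equiv> lecn h R prec A"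

text \<open>Up to factors that depend only on \<open>q\<close>, this is the size of every coupling of \<open>K\<close>.\<close>
definition scale :: "cell \<Rightarrow> real" where
  "scale K = edge h K * \<sigma> (center h K)"

definition outflow :: "cell \<Rightarrow> real" where
  "outflow K = (\<Sum>L \<in> succeeding h R prec K. weight h \<sigma> K L)"

text \<open>The denominator of the estimator: the sum of the pivot of \<open>K\<close> and the entries in the row of \<open>K\<close>
  that belong to later cells.\<close>
definition slack :: "cell \<Rightarrow> real" where
  "slack K = pivot K - outflow K"

lemma scale_pos: "K \<in> R \<Longrightarrow> 0 < scale K"
  by (simp add: scale_def edge_pos[OF h_pos] \<sigma>_pos)

lemma neighbours_subset: "neighbours h R K \<subseteq> R"
  by (auto simp: neighbours_def)

lemma level_cases:
  assumes "K \<in> R" "L \<in> neighbours h R K"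
  obtains "level L = level K" | "level K = level L + 1" | "level L = level K + 1"
proof -
  have "\<bar>int (level L) - int (level K)\<bar> \<le> 1"
    using graded assms neighbours_subset unfolding graded_def by blast
  then show ?thesis using that by linarith
qed

text \<open>A weight is the edge length, or twice the edge length, times the inverse of a sum of reciprocal
  coefficients. In each of the three cases for the levels that sum lies between \<open>1 / a\<close> and
  \<open>(1 + 2 q) / a\<close>, where \<open>a\<close> is the coefficient at \<open>K\<close>.\<close>
lemma weight_bounds:
  assumes K: "K \<in> R" and L: "L \<in> neighbours h R K"
  shows "scale K / (1 + 2 * q) \<le> weight h \<sigma> K L" "weight h \<sigma> K L \<le> 2 * scale K"
proof -
  define a b l where "a = \<sigma> (center h K)" "b = \<sigma> (center h L)" "l = edge h K"
  have pos: "0 < a" "0 < b" "0 < l" "a \<le> q * b"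
    using K L neighbours_subset \<sigma>_pos \<sigma>_ratio edge_pos[OF h_pos] by (auto simp: a_b_l_def)
  then have inv: "inverse b \<le> q * inverse a" "0 < inverse a" "0 < inverse b" by (simp_all add: field_simps)
  have mono: "inverse a \<le> q * inverse a"
    using q_ge_1 inv by simp
  have split: "(1 + 2 * q) * inverse a = inverse a + 2 * (q * inverse a)"
    by (simp add: algebra_simps)
  obtain D where D: "inverse a \<le> D" "D \<le> (1 + 2 * q) * inverse a"
    and w: "weight h \<sigma> K L = 2 * l * inverse D \<or> weight h \<sigma> K L = l * inverse D"
    using K L
  proof (cases rule: level_cases)
    case 1
    show ?thesis
    proof (rule that)
      show "weight h \<sigma> K L = 2 * l * inverse (inverse a + inverse b) \<or>
          weight h \<sigma> K L = l * inverse (inverse a + inverse b)"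
        using 1 by (simp add: weight_def coupling_def a_b_l_def Let_def)
      show "inverse a \<le> inverse a + inverse b" "inverse a + inverse b \<le> (1 + 2 * q) * inverse a"
        using inv mono split by linarith+
    qed
  next
    case 2
    show ?thesis
    proof (rule that)
      show "weight h \<sigma> K L = 2 * l * inverse (inverse a + 2 * inverse b) \<or>
          weight h \<sigma> K L = l * inverse (inverse a + 2 * inverse b)"
        using 2 by (simp add: weight_def coupling_def a_b_l_def Let_def)
      show "inverse a \<le> inverse a + 2 * inverse b" "inverse a + 2 * inverse b \<le> (1 + 2 * q) * inverse a"
        using inv mono split by linarith+
    qed
  next
    case 3
    have "2 * edge h L = l" using 3 by (simp add: edge_def a_b_l_def)
    show ?thesis
    proof (rule that)
      show "weight h \<sigma> K L = 2 * l * inverse (inverse b + 2 * inverse a) \<or>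
          weight h \<sigma> K L = l * inverse (inverse b + 2 * inverse a)"
        using 3 \<open>2 * edge h L = l\<close> by (simp add: weight_def coupling_def a_b_l_def Let_def)
      show "inverse a \<le> inverse b + 2 * inverse a" "inverse b + 2 * inverse a \<le> (1 + 2 * q) * inverse a"
        using inv mono split by linarith+
    qed
  qed
  have "0 < 1 + 2 * q" using q_ge_1 by simp
  note I = inverse_between[OF pos(1) this D]
  have "scale K / (1 + 2 * q) = l * (a / (1 + 2 * q))" "2 * scale K = 2 * l * a"
    by (simp_all add: scale_def a_b_l_def)
  moreover have "l * (a / (1 + 2 * q)) \<le> l * inverse D" "l * inverse D \<le> l * a"
    using I pos(3) by (intro mult_left_mono; simp)+
  moreover have "0 \<le> D" using D(1) inv(2) by linarith
  then have "0 \<le> l * inverse D" using pos(3) by simp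
  ultimately show "scale K / (1 + 2 * q) \<le> weight h \<sigma> K L" "weight h \<sigma> K L \<le> 2 * scale K"
    using w by (auto simp del: times_divide_eq_right)
qed

lemma weight_pos: "K \<in> R \<Longrightarrow> L \<in> neighbours h R K \<Longrightarrow> 0 < weight h \<sigma> K L"
  using weight_bounds(1)[of K L] scale_pos[of K] q_ge_1
  by (smt (verit) divide_pos_pos)

lemma card_neighbours:
  assumes K: "K \<in> R"
  shows "card (neighbours h R K) \<le> neighbour_bound"
proof -
  define base where "base t e = (if t = 0 then index K $ e div 2 - 1 else
    if t = 1 then index K $ e - 1 else 2 * index K $ e - 1)" for t :: nat and e
  define g where "g = (\<lambda>(t, j :: nat ^ 3). Cell (level K + t - 1) (\<chi> e. base t e + j $ e))"
  define T where "T = {..2 :: nat} \<times> {i :: nat ^ 3. \<forall>d. i $ d < (\<chi> d. 4) $ d}"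
  have "neighbours h R K \<subseteq> g ` T"
  proof
    fix L assume L: "L \<in> neighbours h R K"
    then obtain d where d: "face_below h d L K \<or> face_below h d K L"
      using neighbours_iff_face_below[OF K] by blast
    have close: "lower h L $ e \<le> upper h K $ e" "lower h K $ e \<le> upper h L $ e" for e
      using d lower_lt_upper[of K e] lower_lt_upper[of L e]
      unfolding face_below_def by (cases "e = d"; force)+
    define t where "t = level L + 1 - level K"
    have "base t e \<le> index L $ e \<and> index L $ e < base t e + 4 \<and> t \<le> 2 \<and> level L = level K + t - 1" for e
      using K L
    proof (cases rule: level_cases)
      case 1
      have "real (index L $ e) * edge h K \<le> (real (index K $ e) + 1) * edge h K"
        "real (index K $ e) * edge h K \<le> (real (index L $ e) + 1) * edge h K"
        using close[of e] 1 by (simp_all add: lower_def upper_def edge_def)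
      then have "real (index L $ e) \<le> real (index K $ e) + 1"
        "real (index K $ e) \<le> real (index L $ e) + 1"
        using edge_pos[OF h_pos] by (simp_all only: mult_le_cancel_right_pos)
      then show ?thesis using 1 by (auto simp: base_def t_def)
    next
      case 2
      have "edge h L = 2 * edge h K" using 2 by (simp add: edge_def)
      then have "2 * real (index L $ e) * edge h K \<le> (real (index K $ e) + 1) * edge h K"
        "real (index K $ e) * edge h K \<le> 2 * (real (index L $ e) + 1) * edge h K"
        using close[of e] by (simp_all add: lower_def upper_def mult_ac)
      then have "2 * real (index L $ e) \<le> real (index K $ e) + 1"
        "real (index K $ e) \<le> 2 * (real (index L $ e) + 1)"
        using edge_pos[OF h_pos] by (simp_all only: mult_le_cancel_right_pos)
      then have "real (2 * index L $ e) \<le> real (index K $ e + 1)"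
        "real (index K $ e) \<le> real (2 * index L $ e + 2)"
        by simp_all
      then have "2 * index L $ e \<le> index K $ e + 1" "index K $ e \<le> 2 * index L $ e + 2"
        by (simp_all only: of_nat_le_iff)
      then show ?thesis using 2 by (auto simp: base_def t_def)
    next
      case 3
      have "edge h K = 2 * edge h L" using 3 by (simp add: edge_def)
      then have "real (index L $ e) * edge h L \<le> 2 * (real (index K $ e) + 1) * edge h L"
        "2 * real (index K $ e) * edge h L \<le> (real (index L $ e) + 1) * edge h L"
        using close[of e] by (simp_all add: lower_def upper_def mult_ac)
      then have "real (index L $ e) \<le> 2 * (real (index K $ e) + 1)"
        "2 * real (index K $ e) \<le> real (index L $ e) + 1"
        using edge_pos[OF h_pos] by (simp_all only: mult_le_cancel_right_pos)
      then have "real (index L $ e) \<le> real (2 * index K $ e + 2)"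
        "real (2 * index K $ e) \<le> real (index L $ e + 1)"
        by simp_all
      then have "index L $ e \<le> 2 * index K $ e + 2" "2 * index K $ e \<le> index L $ e + 1"
        by (simp_all only: of_nat_le_iff)
      then show ?thesis using 3 by (auto simp: base_def t_def)
    qed
    note in_range = this
    have "L = g (t, \<chi> e. index L $ e - base t e)"
      using in_range by (cases L) (simp add: g_def vec_eq_iff)
    moreover have "(t, \<chi> e. index L $ e - base t e) \<in> T"
    proof -
      have "index L $ e - base t e < 4" for e using in_range[of e] by linarith
      then show ?thesis using in_range by (simp add: T_def)
    qed
    ultimately show "L \<in> g ` T" by blast
  qed
  moreover have "finite T" unfolding T_def by (intro finite_cartesian_product finite_index_box) simp
  ultimately have "card (neighbours h R K) \<le> card T" by (rule surj_card_le[rotated])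
  then show ?thesis by (simp only: neighbour_bound_def T_def)
qed

lemma succeeding_subset: "succeeding h R prec K \<subseteq> neighbours h R K"
  and preceding_subset: "preceding h R prec K \<subseteq> neighbours h R K"
  by (auto simp: succeeding_def preceding_def)

lemma outflow_nonneg: "K \<in> R \<Longrightarrow> 0 \<le> outflow K"
  unfolding outflow_def using succeeding_subset weight_pos by (intro sum_nonneg less_imp_le) blast

lemma outflow_le:
  assumes "K \<in> R"
  shows "outflow K \<le> 2 * neighbour_bound * scale K"
proof -
  have "outflow K \<le> (\<Sum>L \<in> succeeding h R prec K. 2 * scale K)"
    unfolding outflow_def using assms succeeding_subset weight_bounds(2) by (intro sum_mono) blast
  also have "\<dots> = real (card (succeeding h R prec K)) * (2 * scale K)" by simp
  also have "\<dots> \<le> real neighbour_bound * (2 * scale K)"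
  proof (intro mult_right_mono)
    have "card (succeeding h R prec K) \<le> neighbour_bound"
      using card_mono[OF finite_neighbours succeeding_subset, of K] card_neighbours[OF assms] by simp
    then show "real (card (succeeding h R prec K)) \<le> real neighbour_bound" by simp
    show "0 \<le> 2 * scale K" using scale_pos[OF assms] by simp
  qed
  finally show ?thesis by (simp add: mult_ac)
qed

lemma matrix_neighbour:
  assumes "L \<in> neighbours h R K"
  shows "A K L = - weight h \<sigma> K L"
  using assms by (auto simp: fv_matrix_def weight_def neighbours_def)

text \<open>The diagonal entry contains all weights of \<open>K\<close>. Those to later cells cancel against the outflow
  that \<open>slack\<close> subtracts, and each of those to earlier cells \<open>L\<close> is diminished by the part
  \<open>outflow L / pivot L\<close> that the elimination of \<open>L\<close> moves to the diagonal.\<close>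
lemma slack_rec:
  assumes K: "K \<in> R"
  shows "slack K = 2 * boundary_faces h N K * scale K +
    (\<Sum>L \<in> preceding h R prec K. weight h \<sigma> K L * (1 - outflow L / pivot L))"
proof -
  let ?w = "weight h \<sigma>" and ?p = "preceding h R prec" and ?s = "succeeding h R prec"
  have fin: "finite (?p K)" "finite (?s K)"
    using finite_subset[OF _ finite_neighbours] preceding_subset succeeding_subset by blast+
  have inner: "(\<Sum>K\<^sub>2 \<in> ?s L. A K L * A L K\<^sub>2 / pivot L) = ?w K L * (outflow L / pivot L)"
    if "L \<in> ?p K" for L
  proof -
    have "(\<Sum>K\<^sub>2 \<in> ?s L. A K L * A L K\<^sub>2 / pivot L) = (\<Sum>K\<^sub>2 \<in> ?s L. ?w K L * ?w L K\<^sub>2 / pivot L)"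
      using that preceding_subset succeeding_subset matrix_neighbour
      by (intro sum.cong refl) (metis minus_mult_minus subsetD)
    also have "\<dots> = ?w K L * (outflow L / pivot L)"
      by (simp add: outflow_def sum_distrib_left sum_divide_distrib)
    finally show ?thesis .
  qed
  have diag: "A K K = (\<Sum>L \<in> ?p K. ?w K L) + outflow K + 2 * boundary_faces h N K * scale K"
  proof -
    have "(\<Sum>L \<in> neighbours h R K. ?w K L) = (\<Sum>L \<in> ?p K. ?w K L) + outflow K"
      unfolding neighbours_eq(1)[OF K] outflow_def
      using fin neighbours_eq(2)[OF K] by (rule sum.union_disjoint)
    then show ?thesis
      by (simp add: fv_matrix_def weight_def scale_def sum_negf)
  qed
  have "pivot K = A K K - (\<Sum>L \<in> ?p K. ?w K L * (outflow L / pivot L))"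
    using milu_pivot_rec[OF order K] inner by (simp cong: sum.cong)
  then show ?thesis
    unfolding slack_def diag
    by (simp add: algebra_simps sum_subtractf)
qed

text \<open>The last equation turns the recursion for \<open>slack\<close> into one in which only weights and
  estimators occur.\<close>
lemma estimator_eq:
  assumes "K \<in> R" "0 < slack K"
  shows "\<tau> K = 1 + outflow K / slack K" "1 \<le> \<tau> K" "1 - outflow K / pivot K = 1 / \<tau> K"
proof -
  have "(\<Sum>L \<in> succeeding h R prec K. A K L) = - outflow K"
    unfolding outflow_def using succeeding_subset matrix_neighbour
    by (subst sum_negf[symmetric]) (intro sum.cong refl, blast)
  then have \<tau>: "\<tau> K = pivot K / slack K" by (simp add: lecn_def slack_def)
  also have "\<dots> = 1 + outflow K / slack K"
    using assms(2) by (simp add: slack_def field_simps)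
  finally show *: "\<tau> K = 1 + outflow K / slack K" .
  show "1 \<le> \<tau> K" using * outflow_nonneg[OF assms(1)] assms(2) by simp
  have "0 < pivot K" using assms(2) outflow_nonneg[OF assms(1)] by (simp add: slack_def)
  then show "1 - outflow K / pivot K = 1 / \<tau> K"
    unfolding \<tau> by (simp add: slack_def field_simps)
qed

lemma boundary_term_nonneg: "K \<in> R \<Longrightarrow> 0 \<le> 2 * boundary_faces h N K * scale K"
  using scale_pos[of K] by simp

lemma face_below_preceding: "K \<in> R \<Longrightarrow> L \<in> R \<Longrightarrow> face_below h d L K \<Longrightarrow> L \<in> preceding h R prec K"
  using preceding_iff by blast

text \<open>In the first coordinate direction, say, either \<open>K\<close> touches the boundary of the domain and the
  Dirichlet term is positive, or a cell below \<open>K\<close> contributes a positive term.\<close>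
lemma slack_pos:
  assumes "K \<in> R"
  shows "0 < slack K"
  using octree_order_wf[OF order] assms
proof (induction K rule: wf_induct_rule)
  case (less K)
  let ?p = "preceding h R prec K"
  have fin: "finite ?p" using finite_subset[OF preceding_subset finite_neighbours] .
  have pos: "0 < weight h \<sigma> K L * (1 - outflow L / pivot L)" if "L \<in> ?p" for L
  proof -
    have "L \<in> R" "prec L K" using that by (auto simp: preceding_def neighbours_def)
    then have "0 < slack L" using less by blast
    then have "0 < 1 - outflow L / pivot L"
      using estimator_eq(2,3)[OF \<open>L \<in> R\<close>] by simp
    moreover have "0 < weight h \<sigma> K L" using weight_pos less.prems that preceding_subset by blast
    ultimately show ?thesis by simp
  qed
  show ?case
  proof (cases "lower h K $ 1 = 0")
    case True
    then have "1 \<le> boundary_faces h N K" using boundary_faces_pos[OF less.prems] by blast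
    then have "0 < 2 * boundary_faces h N K * scale K" using scale_pos[OF less.prems] by simp
    moreover have "0 \<le> (\<Sum>L \<in> ?p. weight h \<sigma> K L * (1 - outflow L / pivot L))"
      using pos by (intro sum_nonneg less_imp_le)
    ultimately show ?thesis unfolding slack_rec[OF less.prems] by linarith
  next
    case False
    then have "0 < lower h K $ 1" using octree_in_domain(1)[OF octree h_pos less.prems, of 1] by simp
    then have "?p \<noteq> {}" using exists_face_below[OF less.prems] face_below_preceding less.prems by blast
    then have "0 < (\<Sum>L \<in> ?p. weight h \<sigma> K L * (1 - outflow L / pivot L))"
      using pos fin by (intro sum_pos)
    then show ?thesis
      unfolding slack_rec[OF less.prems] using boundary_term_nonneg[OF less.prems] by linarith
  qed
qed

lemmas estimator = estimator_eq[OF _ slack_pos]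

lemma estimator_ge_1: "K \<in> R \<Longrightarrow> 1 \<le> \<tau> K"
  using estimator(2) by blast

text \<open>Apart from the Dirichlet term, the excess of \<open>K\<close> is a weighted sum of the reciprocal estimators
  of its predecessors. This is the recursion on which all estimates rest.\<close>
lemma slack_eq:
  assumes "K \<in> R"
  shows "slack K = 2 * boundary_faces h N K * scale K +
    (\<Sum>L \<in> preceding h R prec K. weight h \<sigma> K L / \<tau> L)"
proof -
  have "1 - outflow L / pivot L = 1 / \<tau> L" if "L \<in> preceding h R prec K" for L
    using that preceding_subset neighbours_subset estimator(3) by blast
  then show ?thesis unfolding slack_rec[OF assms] by (simp cong: sum.cong)
qed

lemma slack_ge:
  assumes "K \<in> R" "I \<subseteq> preceding h R prec K"
  shows "(\<Sum>L \<in> I. weight h \<sigma> K L / \<tau> L) \<le> slack K"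
proof -
  have "(\<Sum>L \<in> I. weight h \<sigma> K L / \<tau> L) \<le> (\<Sum>L \<in> preceding h R prec K. weight h \<sigma> K L / \<tau> L)"
  proof (intro sum_mono2)
    show "finite (preceding h R prec K)"
      using finite_subset[OF preceding_subset finite_neighbours] .
    fix L assume "L \<in> preceding h R prec K - I"
    then have "L \<in> neighbours h R K" "L \<in> R" using preceding_subset neighbours_subset by blast+
    then show "0 \<le> weight h \<sigma> K L / \<tau> L"
      using weight_pos[OF assms(1)] estimator_ge_1[of L] by (simp add: less_imp_le)
  qed (fact assms(2))
  then show ?thesis
    unfolding slack_eq[OF assms(1)] using boundary_term_nonneg[OF assms(1)] by linarith
qed

lemma estimator_le:
  assumes "K \<in> R" "0 < M" "0 \<le> \<rho>" "outflow K \<le> \<rho> * D" "D / M \<le> slack K"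
  shows "\<tau> K \<le> 1 + \<rho> * M"
proof -
  have "outflow K \<le> \<rho> * D" by (fact assms(4))
  also have "\<dots> \<le> \<rho> * (M * slack K)"
    using assms(2,3,5) by (intro mult_left_mono) (simp_all add: field_simps)
  finally have "outflow K / slack K \<le> \<rho> * M"
    using slack_pos[OF assms(1)] by (simp add: field_simps)
  then show ?thesis using estimator(1)[OF assms(1)] assms(1) by simp
qed

text \<open>A single predecessor controls the estimator, at the cost of a fixed factor. This is affordable
  only boundedly often along a path of cells, but it holds however the couplings to later cells
  compare with those to earlier ones.\<close>
lemma estimator_jump:
  assumes "K \<in> R" "L \<in> R" "face_below h d L K"
  shows "\<tau> K \<le> 1 + jump_factor q * \<tau> L"
proof (rule estimator_le)
  show "0 < \<tau> L" using estimator_ge_1[OF assms(2)] by simp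
  show "outflow K \<le> jump_factor q * (scale K / (1 + 2 * q))"
    using outflow_le[OF assms(1)] q_ge_1 by (simp add: jump_factor_def)
  have L: "L \<in> preceding h R prec K" using face_below_preceding assms by blast
  then have "scale K / (1 + 2 * q) / \<tau> L \<le> weight h \<sigma> K L / \<tau> L"
    using weight_bounds(1)[OF assms(1)] preceding_subset \<open>0 < \<tau> L\<close>
    by (intro divide_right_mono) auto
  also have "\<dots> \<le> slack K" using slack_ge[OF assms(1), of "{L}"] L by simp
  finally show "scale K / (1 + 2 * q) / \<tau> L \<le> slack K" .
qed (use assms jump_factor_nonneg[OF q_ge_1] in auto)

text \<open>A boundary face acts like a predecessor with estimator one.\<close>
lemma estimator_boundary:
  assumes "K \<in> R" "lower h K $ d = 0"
  shows "\<tau> K \<le> 1 + jump_factor q"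
proof -
  have "\<tau> K \<le> 1 + jump_factor q * 1"
  proof (rule estimator_le)
    show "outflow K \<le> jump_factor q * (scale K / (1 + 2 * q))"
      using outflow_le[OF assms(1)] q_ge_1 by (simp add: jump_factor_def)
    have s: "0 < scale K" by (rule scale_pos[OF assms(1)])
    have "scale K / (1 + 2 * q) \<le> scale K / 1"
      using q_ge_1 s by (intro divide_left_mono) auto
    also have "\<dots> \<le> 2 * boundary_faces h N K * scale K"
      using boundary_faces_pos[OF assms] s by simp
    also have "\<dots> \<le> slack K"
    proof -
      have "0 \<le> (\<Sum>L \<in> preceding h R prec K. weight h \<sigma> K L / \<tau> L)"
      proof (intro sum_nonneg)
        fix L assume "L \<in> preceding h R prec K"
        then have "L \<in> neighbours h R K" "L \<in> R" using preceding_subset neighbours_subset by blast+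
        then show "0 \<le> weight h \<sigma> K L / \<tau> L"
          using weight_pos[OF assms(1)] estimator_ge_1[of L] by (simp add: less_imp_le)
      qed
      then show ?thesis unfolding slack_eq[OF assms(1)] by simp
    qed
    finally show "scale K / (1 + 2 * q) / 1 \<le> slack K" by simp
  qed (use assms jump_factor_nonneg[OF q_ge_1] in auto)
  then show ?thesis by simp
qed

lemma face_below_direction_unique: "face_below h d K L \<Longrightarrow> face_below h e K L \<Longrightarrow> d = e"
  unfolding face_below_def by force

text \<open>If the couplings upwards are at most \<open>1 + \<epsilon>\<close> times those downwards, the estimator grows
  essentially by one only.\<close>
lemma estimator_step:
  assumes K: "K \<in> R"
    and dn: "\<And>d. dn d \<in> R" "\<And>d. face_below h d (dn d) K"
    and up: "\<And>d. up d \<in> R" "\<And>d. face_below h d K (up d)"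
    and all: "succeeding h R prec K \<subseteq> range up"
    and ratio: "\<And>d. weight h \<sigma> K (up d) \<le> (1 + \<epsilon>) * weight h \<sigma> K (dn d)"
    and M: "\<And>d. \<tau> (dn d) \<le> M" and "0 \<le> \<epsilon>"
  shows "\<tau> K \<le> 1 + (1 + \<epsilon>) * M"
proof (rule estimator_le[OF K])
  have inj: "inj dn" "inj up"
    using dn(2) up(2) face_below_direction_unique by (metis injI)+
  have "1 \<le> M" using estimator_ge_1[OF dn(1)] M by (rule order_trans)
  then show "0 < M" by simp
  show "0 \<le> 1 + \<epsilon>" using \<open>0 \<le> \<epsilon>\<close> by simp
  let ?D = "\<Sum>d \<in> UNIV. weight h \<sigma> K (dn d)"
  have up_nb: "up d \<in> neighbours h R K" and dn_pre: "dn d \<in> preceding h R prec K" for d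
    using succeeding_iff[OF K] up succeeding_subset preceding_iff[OF K] dn by blast+
  have "outflow K \<le> (\<Sum>L \<in> range up. weight h \<sigma> K L)"
    unfolding outflow_def using all up_nb weight_pos[OF K]
    by (intro sum_mono2) (auto simp: less_imp_le)
  also have "\<dots> = (\<Sum>d \<in> UNIV. weight h \<sigma> K (up d))"
    using sum.reindex[OF inj(2)] by simp
  also have "\<dots> \<le> (\<Sum>d \<in> UNIV. (1 + \<epsilon>) * weight h \<sigma> K (dn d))"
    by (intro sum_mono ratio)
  finally show "outflow K \<le> (1 + \<epsilon>) * ?D" by (simp add: sum_distrib_left)
  have "?D / M = (\<Sum>d \<in> UNIV. weight h \<sigma> K (dn d) / M)" by (simp add: sum_divide_distrib)
  also have "\<dots> \<le> (\<Sum>d \<in> UNIV. weight h \<sigma> K (dn d) / \<tau> (dn d))"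
  proof (intro sum_mono divide_left_mono M)
    fix d
    show "0 \<le> weight h \<sigma> K (dn d)" using weight_pos[OF K] dn_pre preceding_subset less_imp_le by blast
    show "0 < M * \<tau> (dn d)" using \<open>0 < M\<close> estimator_ge_1[OF dn(1), of d] by simp
  qed
  also have "\<dots> = (\<Sum>L \<in> range dn. weight h \<sigma> K L / \<tau> L)"
    by (simp add: sum.reindex[OF inj(1)])
  also have "\<dots> \<le> slack K" using dn_pre by (intro slack_ge[OF K]) blast
  finally show "?D / M \<le> slack K" .
qed

end

section \<open>Uniform refinements\<close>
lemma face_below_subcells:
  assumes "h > 0" "1 \<le> i $ d"
  shows "face_below h d (subcell n C i) (subcell n C (i + axis d 1))"
proof -
  have ed: "0 < edge h C / 2 ^ n" using edge_pos[OF assms(1)] by simp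
  have shift: "real ((i + axis d 1) $ d - 1) = real (i $ d - 1) + 1"
    using assms(2) by (simp add: axis_def of_nat_diff)
  have "upper h (subcell n C i) $ d = lower h (subcell n C (i + axis d 1)) $ d"
    by (simp only: upper_eq lower_subcell edge_subcell shift distrib_right mult_1_left add.assoc)
  moreover have "lower h (subcell n C (i + axis d 1)) $ e = lower h (subcell n C i) $ e" if "e \<noteq> d" for e
    using that by (simp add: lower_subcell axis_def)
  ultimately show ?thesis
    using ed by (simp add: face_below_def upper_eq edge_subcell)
qed

lemma subcell_extent_shift:
  assumes "e \<noteq> d"
  shows "lower h (subcell n C (i + axis d 1)) $ e = lower h (subcell n C i) $ e"
    "upper h (subcell n C (i + axis d 1)) $ e = upper h (subcell n C i) $ e"
  using assms by (simp_all add: upper_eq lower_subcell edge_subcell axis_def)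

lemma subcell_in_refined:
  "C \<in> R \<Longrightarrow> (\<And>d. i $ d \<in> {1..2 ^ n}) \<Longrightarrow> subcell n C i \<in> refined n R"
  unfolding refined_eq_subcells by blast

lemma dominated_subcell:
  assumes "h > 0" "\<And>d. i $ d \<in> {1..2 ^ n}" "\<And>d. j $ d \<in> {1..2 ^ n}"
    and "dominated h (subcell n C i) (subcell n D j)"
  shows "dominated h C D"
  using assms(4) subcell_within(1)[OF assms(1,2)] subcell_within(2)[OF assms(1,3)]
  unfolding dominated_def by (meson order_le_less_trans order_less_le_trans)

context ordered_octree
begin

text \<open>The subcells overlap tangentially, hence so do \<open>C\<close> and \<open>D\<close>. These cells are disjoint up to their
  boundaries, so they are separated in direction \<open>d\<close>, and the common plane of the subcells leaves
  no gap.\<close>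
lemma face_below_coarsen:
  assumes C: "C \<in> R" and D: "D \<in> R" and "C \<noteq> D"
    and i: "\<And>d. i $ d \<in> {1..2 ^ n}" and j: "\<And>d. j $ d \<in> {1..2 ^ n}"
    and below: "face_below h d (subcell n C i) (subcell n D j)"
  shows "face_below h d C D"
proof -
  have dom: "dominated h C D"
    using dominated_subcell[OF h_pos i j] face_below_dominated[OF h_pos below] .
  then have "\<not> dominated h D C" using dominated_antisym C D \<open>C \<noteq> D\<close> by blast
  then obtain e where e: "upper h C $ e \<le> lower h D $ e"
    unfolding dominated_def by (auto simp: not_less)
  have tang: "lower h D $ f < upper h C $ f" if "f \<noteq> d" for f
  proof -
    have "lower h D $ f \<le> lower h (subcell n D j) $ f" by (rule subcell_within[OF h_pos j])
    also have "\<dots> < upper h (subcell n C i) $ f" using below that by (simp add: face_below_def)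
    also have "\<dots> \<le> upper h C $ f" by (rule subcell_within[OF h_pos i])
    finally show ?thesis .
  qed
  then have "e = d" using e by force
  have "lower h D $ d \<le> lower h (subcell n D j) $ d" by (rule subcell_within[OF h_pos j])
  also have "\<dots> = upper h (subcell n C i) $ d" using below by (simp add: face_below_def)
  also have "\<dots> \<le> upper h C $ d" by (rule subcell_within[OF h_pos i])
  finally have "upper h C $ d = lower h D $ d" using e \<open>e = d\<close> by simp
  then show ?thesis
    using tang dom unfolding face_below_def dominated_def by blast
qed

text \<open>Two cells above the same face overlap if one of them has the full extent of that face.\<close>
lemma face_above_unique:
  assumes "L \<in> R" "U \<in> R" "face_below h d K L" "face_below h d K U"
    and same: "\<And>e. e \<noteq> d \<Longrightarrow> lower h U $ e = lower h K $ e"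
      "\<And>e. e \<noteq> d \<Longrightarrow> upper h U $ e = upper h K $ e"
  shows "L = U"
proof (rule dominated_antisym)
  show "dominated h L U" unfolding dominated_def
  proof
    fix e show "lower h L $ e < upper h U $ e"
      using assms(3,4) same lower_lt_upper[of U e] by (cases "e = d") (auto simp: face_below_def)
  qed
  show "dominated h U L" unfolding dominated_def
  proof
    fix e show "lower h U $ e < upper h L $ e"
      using assms(3,4) same lower_lt_upper[of L e] by (cases "e = d") (auto simp: face_below_def)
  qed
qed fact+

end

text \<open>Subcells of one cell have equal levels, and subcells of different cells can touch along a face
  only if the cells do.\<close>
lemma graded_refined:
  assumes "h > 0" "octree N R" "graded h R"
  shows "graded h (refined n R)"
proof -
  obtain prec where prec: "octree_order N R prec" using octree_order_exists assms(2) by blast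
  obtain prec' where prec': "octree_order N (refined n R) prec'"
    using octree_order_exists octree_refined assms(2) by blast
  interpret coarse: ordered_octree h N R prec using assms(1) prec by unfold_locales
  interpret fine: ordered_octree h N "refined n R" prec' using assms(1) prec' by unfold_locales
  have main: "\<bar>int (level K) - int (level L)\<bar> \<le> 1"
    if K: "K \<in> refined n R" and L: "L \<in> refined n R" and below: "face_below h d K L" for K L d
  proof -
    obtain C i where C: "C \<in> R" "K = subcell n C i" and i: "\<And>d. i $ d \<in> {1..2 ^ n}"
      using K unfolding refined_eq_subcells by blast
    obtain D j where D: "D \<in> R" "L = subcell n D j" and j: "\<And>d. j $ d \<in> {1..2 ^ n}"
      using L unfolding refined_eq_subcells by blast
    have "\<bar>int (level C) - int (level D)\<bar> \<le> 1"
    proof (cases "C = D")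
      case False
      then have "face_below h d C D"
        using coarse.face_below_coarsen C D i j below by blast
      then have "C \<in> neighbours h R D"
        using coarse.neighbours_iff_face_below C(1) D(1) by blast
      then show ?thesis using assms(3) C(1) D(1) unfolding graded_def by blast
    qed simp
    then show ?thesis by (simp add: C(2) D(2) subcell_def)
  qed
  show ?thesis unfolding graded_def
  proof (intro ballI impI)
    fix K L assume KL: "K \<in> refined n R" "L \<in> refined n R" "K \<in> neighbours h (refined n R) L"
    then obtain d where "face_below h d K L \<or> face_below h d L K"
      using fine.neighbours_iff_face_below by blast
    then show "\<bar>int (level K) - int (level L)\<bar> \<le> 1"
      using main[of K L d] main[of L K d] KL by fastforce
  qed
qed

text \<open>With \<open>u\<close> and \<open>v\<close> the coefficients at two neighbours of a cell with coefficient \<open>s\<close>, this compares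
  the two couplings of the cell when all levels are equal. The difference of \<open>u\<close> and \<open>v\<close> enters
  linearly, which is what makes the relative error of order \<open>2 ^ -n\<close>.\<close>
lemma harmonic_mean_ratio:
  fixes s u v t q :: real
  assumes "0 < s" "0 < u" "0 < v" "u - v \<le> t * s" "s \<le> q * v" "0 \<le> t"
  shows "inverse (inverse s + inverse u) \<le> (1 + t * q) * inverse (inverse s + inverse v)"
proof -
  have hm: "inverse (inverse s + inverse x) = s * x / (s + x)" if "0 < x" for x
    using that assms(1) by (simp add: field_simps)
  have "0 < q * v" using assms(1,5) by simp
  have "s * (u - v) \<le> (q * v) * (t * s)"
    using assms \<open>0 < q * v\<close>
    by (metis less_imp_le mult_left_mono mult_right_mono mult_nonneg_nonneg order_trans)
  also have "\<dots> \<le> (q * v) * (t * (s + u))"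
    using assms \<open>0 < q * v\<close> by (intro mult_left_mono) auto
  finally have "s * (u - v) \<le> t * q * (v * (s + u))" by (simp add: mult_ac)
  then have "u * (s + v) \<le> (1 + t * q) * v * (s + u)" by (simp add: algebra_simps)
  then have "u / (s + u) \<le> (1 + t * q) * v / (s + v)"
    using assms(1-3) by (simp add: pos_divide_le_eq pos_le_divide_eq mult_ac)
  then have "s * (u / (s + u)) \<le> s * ((1 + t * q) * v / (s + v))"
    using assms(1) by (intro mult_left_mono) simp_all
  then show ?thesis
    unfolding hm[OF assms(2)] hm[OF assms(3)] by (simp add: mult_ac)
qed

lemma axis_shift:
  fixes i :: "nat ^ 3"
  assumes "2 \<le> i $ d"
  obtains j where "i = j + axis d 1" "1 \<le> j $ d"
proof
  show "i = (i - axis d 1) + axis d 1" "1 \<le> (i - axis d 1) $ d"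
    using assms by (auto simp: vec_eq_iff axis_def)
qed

lemma sum_axis_shift:
  fixes j :: "nat ^ 3"
  shows "(\<Sum>e\<in>UNIV. (j + axis d 1) $ e) = Suc (\<Sum>e\<in>UNIV. j $ e)"
  by (simp add: sum.distrib axis_def)

context fv_octree
begin

text \<open>Away from the upper faces of \<open>C\<close> all later neighbours of a subcell are subcells of \<open>C\<close>, too.
  Moving towards the lower faces of \<open>C\<close> decreases the sum of the indices, so that the estimator
  grows at most by one plus a relative error of \<open>\<epsilon>\<close> per unit of that sum, starting from the
  bound \<open>M\<close> at the lower faces.\<close>
lemma estimator_interior:
  assumes R: "R = refined n R\<^sub>0" and C: "C \<in> R\<^sub>0" and "1 \<le> M" "0 \<le> \<epsilon>"
    and inflow: "\<And>i d. (\<And>e. i $ e \<in> {1..2 ^ n}) \<Longrightarrow> i $ d = 1 \<Longrightarrow> \<tau> (subcell n C i) \<le> M"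
    and ratio: "\<And>K L L'. K \<in> R \<Longrightarrow> L \<in> neighbours h R K \<Longrightarrow> L' \<in> neighbours h R K \<Longrightarrow>
      level L = level K \<Longrightarrow> level L' = level K \<Longrightarrow> weight h \<sigma> K L \<le> (1 + \<epsilon>) * weight h \<sigma> K L'"
    and "\<And>e. 1 \<le> i $ e" "\<And>e. i $ e < 2 ^ n"
  shows "\<tau> (subcell n C i) \<le> (M + real (\<Sum>e\<in>UNIV. i $ e)) * (1 + \<epsilon>) ^ (\<Sum>e\<in>UNIV. i $ e)"
  using assms(7,8)
proof (induction "\<Sum>e\<in>UNIV. i $ e" arbitrary: i rule: less_induct)
  case (less i)
  define s where "s = (\<Sum>e\<in>UNIV. i $ e)"
  have range: "i $ e \<in> {1..2 ^ n}" for e using less.prems[of e] by simp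
  have pow: "1 \<le> (1 + \<epsilon>) ^ k" for k using \<open>0 \<le> \<epsilon>\<close> by simp
  show ?case
  proof (cases "\<exists>d. i $ d = 1")
    case True
    then have "\<tau> (subcell n C i) \<le> M" using inflow[OF range] by blast
    also have "\<dots> \<le> (M + real s) * 1" by simp
    also have "\<dots> \<le> (M + real s) * (1 + \<epsilon>) ^ s"
      using \<open>1 \<le> M\<close> by (intro mult_left_mono pow) simp
    finally show ?thesis unfolding s_def .
  next
    case False
    then have two: "2 \<le> i $ d" for d using range[of d] by (metis One_nat_def Suc_1 Suc_leI atLeastAtMost_iff le_neq_implies_less)
    then have "\<exists>j. i = j + axis d 1 \<and> 1 \<le> j $ d" for d by (metis axis_shift)
    then obtain j where j: "\<And>d. i = j d + axis d 1" "\<And>d. 1 \<le> j d $ d" by metis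
    have j_nth: "j d $ e = (if e = d then i $ e - 1 else i $ e)" for d e
      using arg_cong[OF j(1)[of d], of "\<lambda>v. v $ e"] by (simp add: axis_def split: if_splits)
    have j_range: "1 \<le> j d $ e" "j d $ e < 2 ^ n" for d e
      using two[of e] less.prems(2)[of e] by (auto simp: j_nth)
    have up_range: "(i + axis d 1) $ e \<in> {1..2 ^ n}" for d e
      using range[of e] less.prems(2)[of e] by (auto simp: axis_def)
    have j_sum: "s = Suc (\<Sum>e\<in>UNIV. j d $ e)" for d
      unfolding s_def using sum_axis_shift[of "j d" d] j(1)[of d] by simp
    let ?K = "subcell n C i"
    define dn where "dn d = subcell n C (j d)" for d
    define up where "up d = subcell n C (i + axis d 1)" for d
    have K: "?K \<in> R" unfolding R using range by (intro subcell_in_refined C)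
    have dn: "dn d \<in> R" "face_below h d (dn d) ?K" for d
    proof -
      show "dn d \<in> R" unfolding R dn_def
        using j_range[of d] by (intro subcell_in_refined C) (simp add: less_imp_le)
      show "face_below h d (dn d) ?K"
        using face_below_subcells[OF h_pos j(2)[of d], of n C] j(1)[of d] by (simp add: dn_def)
    qed
    have up: "up d \<in> R" "face_below h d ?K (up d)" for d
    proof -
      show "up d \<in> R" unfolding R up_def by (intro subcell_in_refined C up_range)
      show "face_below h d ?K (up d)"
        unfolding up_def using less.prems(1) by (intro face_below_subcells h_pos)
    qed
    have step: "\<tau> ?K \<le> 1 + (1 + \<epsilon>) * ((M + real (s - 1)) * (1 + \<epsilon>) ^ (s - 1))"
    proof (rule estimator_step[OF K dn up])
      show "succeeding h R prec ?K \<subseteq> range up"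
      proof
        fix L assume "L \<in> succeeding h R prec ?K"
        then obtain d where "L \<in> R" "face_below h d ?K L" using succeeding_iff[OF K] by blast
        then have "L = up d"
          using face_above_unique[OF _ up(1) _ up(2)] subcell_extent_shift[of _ d h n C i]
          by (simp add: up_def)
        then show "L \<in> range up" by blast
      qed
      show "weight h \<sigma> ?K (up d) \<le> (1 + \<epsilon>) * weight h \<sigma> ?K (dn d)" for d
      proof (rule ratio[OF K])
        show "up d \<in> neighbours h R ?K" "dn d \<in> neighbours h R ?K"
          using neighbours_iff_face_below[OF K] up dn by blast+
      qed (simp_all add: up_def dn_def subcell_def)
      show "\<tau> (dn d) \<le> (M + real (s - 1)) * (1 + \<epsilon>) ^ (s - 1)" for d
      proof -
        have "(\<Sum>e\<in>UNIV. j d $ e) = s - 1" using j_sum[of d] by simp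
        moreover have "(\<Sum>e\<in>UNIV. j d $ e) < (\<Sum>e\<in>UNIV. i $ e)" using j_sum[of d] unfolding s_def by simp
        ultimately show ?thesis using less.hyps[of "j d"] j_range[of d] by (simp add: dn_def)
      qed
    qed fact
    have s: "s = Suc (s - 1)" using j_sum[of 1] by simp
    then have *: "real s = real (s - 1) + 1" "(1 + \<epsilon>) ^ s = (1 + \<epsilon>) * (1 + \<epsilon>) ^ (s - 1)"
      by (metis of_nat_Suc add.commute) (metis s power_Suc)
    have "1 + (1 + \<epsilon>) * ((M + real (s - 1)) * (1 + \<epsilon>) ^ (s - 1)) = 1 + (M + real (s - 1)) * (1 + \<epsilon>) ^ s"
      unfolding *(2) by (simp add: mult_ac)
    also have "\<dots> \<le> (1 + \<epsilon>) ^ s + (M + real (s - 1)) * (1 + \<epsilon>) ^ s"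
      using pow by simp
    also have "\<dots> = (M + real s) * (1 + \<epsilon>) ^ s"
      unfolding *(1) by (simp add: distrib_right distrib_left add_ac)
    finally show ?thesis using step unfolding s_def by linarith
  qed
qed

text \<open>At the upper faces of \<open>C\<close> the couplings upwards may lead to cells of another level and need not
  be close to those downwards. The estimator there is compared only with that of the subcell one
  step further inside, perpendicular to the face. Such a step lowers the number of upper faces
  that the subcell touches, so at most three of them occur. Following the face instead would
  accumulate a fixed factor in each of up to \<open>2 ^ n\<close> steps.\<close>
lemma estimator_subcell:
  assumes R: "R = refined n R\<^sub>0" and C: "C \<in> R\<^sub>0" and "1 \<le> M" "0 \<le> \<epsilon>"
    and inflow: "\<And>i d. (\<And>e. i $ e \<in> {1..2 ^ n}) \<Longrightarrow> i $ d = 1 \<Longrightarrow> \<tau> (subcell n C i) \<le> M"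
    and ratio: "\<And>K L L'. K \<in> R \<Longrightarrow> L \<in> neighbours h R K \<Longrightarrow> L' \<in> neighbours h R K \<Longrightarrow>
      level L = level K \<Longrightarrow> level L' = level K \<Longrightarrow> weight h \<sigma> K L \<le> (1 + \<epsilon>) * weight h \<sigma> K L'"
    and i: "\<And>e. i $ e \<in> {1..2 ^ n}"
  shows "\<tau> (subcell n C i) \<le> (1 + jump_factor q) ^ 3 * ((M + 3 * 2 ^ n) * (1 + \<epsilon>) ^ (3 * 2 ^ n))"
proof -
  define Y where "Y = (M + 3 * 2 ^ n) * (1 + \<epsilon>) ^ (3 * 2 ^ n)"
  have J: "0 \<le> jump_factor q" using jump_factor_nonneg q_ge_1 .
  have M_le: "M \<le> Y"
  proof -
    have "M \<le> (M + 3 * 2 ^ n) * 1" by simp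
    also have "\<dots> \<le> Y" unfolding Y_def
      using \<open>1 \<le> M\<close> \<open>0 \<le> \<epsilon>\<close> by (intro mult_left_mono one_le_power) simp_all
    finally show ?thesis .
  qed
  then have Y: "1 \<le> Y" using \<open>1 \<le> M\<close> by simp
  have "\<tau> (subcell n C i) \<le> (1 + jump_factor q) ^ card {e. i $ e = 2 ^ n} * Y"
    using i
  proof (induction "card {e. i $ e = 2 ^ n}" arbitrary: i rule: less_induct)
    case (less i)
    note i = less.prems
    have pow: "1 \<le> (1 + jump_factor q) ^ k" for k using J by simp
    consider d where "i $ d = 1" | "\<And>e. i $ e < 2 ^ n" | d where "i $ d = 2 ^ n" "2 \<le> i $ d"
    proof -
      have "i $ d = 1 \<or> i $ d < 2 ^ n \<or> i $ d = 2 ^ n \<and> 2 \<le> i $ d" for d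
      proof -
        have "x = 1 \<or> x < m \<or> x = m \<and> 2 \<le> x" if "1 \<le> x" "x \<le> m" for x m :: nat
          using that by linarith
        then show ?thesis using i[of d] by simp
      qed
      then show ?thesis using that by metis
    qed
    then show ?case
    proof cases
      case 1
      then have "\<tau> (subcell n C i) \<le> 1 * Y" using inflow[OF i] M_le by fastforce
      also have "\<dots> \<le> (1 + jump_factor q) ^ card {e. i $ e = 2 ^ n} * Y"
        using Y by (intro mult_right_mono pow) simp
      finally show ?thesis .
    next
      case 2
      define s where "s = (\<Sum>e\<in>UNIV. i $ e)"
      have "s \<le> (\<Sum>e\<in>(UNIV :: 3 set). 2 ^ n)"
        unfolding s_def using 2 by (intro sum_mono less_imp_le)
      then have s: "s \<le> 3 * 2 ^ n" by simp
      then have "real s \<le> 3 * 2 ^ n" by (metis of_nat_le_iff of_nat_mult of_nat_numeral of_nat_power)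
      have "1 \<le> i $ e" for e using i[of e] by simp
      then have "\<tau> (subcell n C i) \<le> (M + real s) * (1 + \<epsilon>) ^ s"
        unfolding s_def using 2
        by (intro estimator_interior[OF R C \<open>1 \<le> M\<close> \<open>0 \<le> \<epsilon>\<close> inflow ratio])
      also have "\<dots> \<le> Y" unfolding Y_def
        using \<open>1 \<le> M\<close> \<open>0 \<le> \<epsilon>\<close> s \<open>real s \<le> 3 * 2 ^ n\<close>
        by (intro mult_mono power_increasing) auto
      also have "\<dots> \<le> (1 + jump_factor q) ^ card {e. i $ e = 2 ^ n} * Y"
        using Y mult_right_mono[OF pow, of Y] by simp
      finally show ?thesis .
    next
      case 3
      obtain j where j: "i = j + axis d 1" "1 \<le> j $ d" using axis_shift[OF 3(2)] .
      have j_nth: "j $ e = (if e = d then i $ e - 1 else i $ e)" for e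
        using arg_cong[OF j(1), of "\<lambda>v. v $ e"] by (simp add: axis_def split: if_splits)
      have j_range: "j $ e \<in> {1..2 ^ n}" for e
        using i[of e] 3(2) by (auto simp: j_nth)
      have "{e. j $ e = 2 ^ n} = {e. i $ e = 2 ^ n} - {d}"
        using 3 by (auto simp: j_nth)
      then have card: "card {e. i $ e = 2 ^ n} = Suc (card {e. j $ e = 2 ^ n})"
        using 3(1) card_Suc_Diff1[of "{e. i $ e = 2 ^ n}" d] by simp
      define k where "k = card {e. j $ e = 2 ^ n}"
      have IH: "\<tau> (subcell n C j) \<le> (1 + jump_factor q) ^ k * Y"
        unfolding k_def using card j_range by (intro less.hyps) auto
      have "\<tau> (subcell n C i) \<le> 1 + jump_factor q * \<tau> (subcell n C j)"
      proof (rule estimator_jump)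
        show "subcell n C i \<in> R" "subcell n C j \<in> R"
          unfolding R using i j_range by (auto intro!: subcell_in_refined C)
        show "face_below h d (subcell n C j) (subcell n C i)"
          unfolding j(1) using h_pos j(2) by (rule face_below_subcells)
      qed
      also have "\<dots> \<le> 1 + jump_factor q * ((1 + jump_factor q) ^ k * Y)"
        using IH J by (intro add_left_mono mult_left_mono)
      also have "\<dots> \<le> (1 + jump_factor q) ^ k * Y + jump_factor q * ((1 + jump_factor q) ^ k * Y)"
        using mult_mono[OF pow[of k] Y] J by simp
      also have "\<dots> = (1 + jump_factor q) ^ Suc k * Y" by (simp add: algebra_simps)
      finally show ?thesis unfolding card k_def .
    qed
  qed
  also have "\<dots> \<le> (1 + jump_factor q) ^ 3 * Y"
  proof (intro mult_right_mono power_increasing)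
    show "card {e. i $ e = 2 ^ n} \<le> 3"
      using card_mono[of "UNIV :: 3 set" "{e. i $ e = 2 ^ n}"] by simp
  qed (use Y J in auto)
  finally show ?thesis unfolding Y_def .
qed

end

section \<open>The bound on octrees\<close>
lemma one_plus_power_le_exp:
  fixes \<kappa> :: real
  assumes "0 \<le> \<kappa>"
  shows "(1 + \<kappa> / 2 ^ n) ^ (3 * 2 ^ n) \<le> exp (3 * \<kappa>)"
proof -
  have "(1 + \<kappa> / 2 ^ n) ^ (3 * 2 ^ n) \<le> exp (\<kappa> / 2 ^ n) ^ (3 * 2 ^ n)"
    using assms by (intro power_mono exp_ge_add_one_self) simp
  also have "\<dots> = exp (real (3 * 2 ^ n) * (\<kappa> / 2 ^ n))" by (rule exp_of_nat_mult[symmetric])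
  also have "real (3 * 2 ^ n) * (\<kappa> / 2 ^ n) = 3 * \<kappa>" by simp
  finally show ?thesis .
qed

theorem theorem4p10:
  fixes h P\<^sub>\<sigma> :: real
    and N :: "nat ^ 3"
    and O\<^sub>0 :: "cell set"
    and \<sigma> :: "real ^ 3 \<Rightarrow> real"
  assumes "h > 0"
    and "\<forall>d. N $ d > 0"
    and "octree N O\<^sub>0"
    and "graded h O\<^sub>0"
    and "\<forall>x \<in> domain h N. \<sigma> x > 0"
    and "C1_on (domain h N) \<sigma>"
    and "\<forall>n. \<forall>C\<^sub>1 \<in> refined n O\<^sub>0. \<forall>C\<^sub>2 \<in> neighbours h (refined n O\<^sub>0) C\<^sub>1.
           \<bar>\<sigma> (center h C\<^sub>2) / \<sigma> (center h C\<^sub>1) - 1\<bar> \<le> P\<^sub>\<sigma> / 2 ^ (n + 1)"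
  shows "\<exists>c :: real. \<forall>n prec. octree_order N (refined n O\<^sub>0) prec \<longrightarrow>
           (\<forall>C \<in> O\<^sub>0. \<forall>i :: nat ^ 3. (\<forall>d. i $ d \<in> {1..2 ^ n}) \<longrightarrow>
              lecn h (refined n O\<^sub>0) prec (fv_matrix h N \<sigma> (refined n O\<^sub>0)) (subcell n C i)
                \<le> c * 2 ^ n)"
proof -
  \<comment> \<open>The maximum with 0 covers the case without neighbouring cells, where the bound may be negative.\<close>
  define p where "p = max 0 P\<^sub>\<sigma>"
  define q where "q = 1 + p / 2"
  define \<kappa> where "\<kappa> = p * q"
  have "0 \<le> p" and q: "1 \<le> q" and "0 \<le> \<kappa>" by (auto simp: p_def q_def \<kappa>_def)
  have J: "0 \<le> jump_factor q" using jump_factor_nonneg q .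
  let ?A = "\<lambda>n. fv_matrix h N \<sigma> (refined n O\<^sub>0)"
  define est_bounded where "est_bounded c C \<longleftrightarrow>
    (\<forall>n prec. octree_order N (refined n O\<^sub>0) prec \<longrightarrow>
      (\<forall>i :: nat ^ 3. (\<forall>d. i $ d \<in> {1..2 ^ n}) \<longrightarrow>
        lecn h (refined n O\<^sub>0) prec (?A n) (subcell n C i) \<le> c * 2 ^ n))" for c :: real and C
  have center_pos: "0 < \<sigma> (center h K)" if "K \<in> refined n O\<^sub>0" for n K
    using center_in_domain[OF octree_refined[OF assms(3)] assms(1) that] assms(5) by blast
  have rel: "\<bar>\<sigma> (center h L) - \<sigma> (center h K)\<bar> \<le> p / 2 ^ (n + 1) * \<sigma> (center h K)"
    if "K \<in> refined n O\<^sub>0" "L \<in> neighbours h (refined n O\<^sub>0) K" for n K L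
  proof -
    have pos: "0 < \<sigma> (center h K)" using center_pos that(1) .
    have "\<bar>\<sigma> (center h L) / \<sigma> (center h K) - 1\<bar> \<le> P\<^sub>\<sigma> / 2 ^ (n + 1)" using assms(7) that by blast
    also have "\<dots> \<le> p / 2 ^ (n + 1)" by (intro divide_right_mono) (simp_all add: p_def)
    finally have "\<bar>\<sigma> (center h L) / \<sigma> (center h K) - 1\<bar> * \<sigma> (center h K) \<le> p / 2 ^ (n + 1) * \<sigma> (center h K)"
      using pos by (intro mult_right_mono) simp_all
    moreover have "\<bar>\<sigma> (center h L) / \<sigma> (center h K) - 1\<bar> * \<sigma> (center h K) =
        \<bar>(\<sigma> (center h L) / \<sigma> (center h K) - 1) * \<sigma> (center h K)\<bar>"
      using pos by (simp only: abs_mult abs_of_pos)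
    moreover have "(\<sigma> (center h L) / \<sigma> (center h K) - 1) * \<sigma> (center h K) = \<sigma> (center h L) - \<sigma> (center h K)"
      using pos by (simp add: field_simps)
    ultimately show ?thesis by simp
  qed
  obtain prec\<^sub>0 where prec\<^sub>0: "octree_order N O\<^sub>0 prec\<^sub>0" using octree_order_exists assms(3) by blast
  interpret coarse: ordered_octree h N O\<^sub>0 prec\<^sub>0 using assms(1) prec\<^sub>0 by unfold_locales
  have "\<exists>c. est_bounded c C" if "C \<in> O\<^sub>0" for C
    using octree_order_wf[OF prec\<^sub>0] that
  proof (induction C rule: wf_induct_rule)
    case (less C)
    have "\<forall>D \<in> {D \<in> O\<^sub>0. prec\<^sub>0 D C}. \<exists>c. est_bounded c D"
      using less by blast
    then obtain f where f: "\<And>D. D \<in> O\<^sub>0 \<Longrightarrow> prec\<^sub>0 D C \<Longrightarrow> est_bounded (f D) D"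
      unfolding bchoice_iff by blast
    define V where "V = insert 1 (f ` {D \<in> O\<^sub>0. prec\<^sub>0 D C})"
    define m where "m = Max V"
    have "finite V" using coarse.finite_cells by (simp add: V_def)
    then have m: "1 \<le> m" and f_le: "\<And>D. D \<in> O\<^sub>0 \<Longrightarrow> prec\<^sub>0 D C \<Longrightarrow> f D \<le> m"
      unfolding m_def by (auto simp: V_def intro!: Max_ge)
    \<comment> \<open>Entering \<open>C\<close> from below costs one jump from the bound \<open>m * 2 ^ n\<close>, crossing \<open>C\<close> the summand
      \<open>3 * 2 ^ n\<close> and the exponential factor, reaching its upper faces three further jumps.\<close>
    define c where "c = (1 + jump_factor q) ^ 3 * (((1 + jump_factor q) * m + 3) * exp (3 * \<kappa>))"
    have c1: "1 \<le> (1 + jump_factor q) * m" using mult_mono[of 1 "1 + jump_factor q" 1 m] J m by simp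
    have "lecn h (refined n O\<^sub>0) prec (?A n) (subcell n C i) \<le> c * 2 ^ n"
      if order: "octree_order N (refined n O\<^sub>0) prec" and i: "\<forall>d. i $ d \<in> {1..2 ^ n}"
      for n prec and i :: "nat ^ 3"
    proof -
      interpret ordered_octree h N "refined n O\<^sub>0" prec
        using assms(1) order by unfold_locales
      have half: "p / 2 ^ (n + 1) \<le> p / 2"
        using \<open>0 \<le> p\<close> by (intro divide_left_mono) simp_all
      have ratio_q: "\<sigma> (center h K) \<le> q * \<sigma> (center h L)"
        if "K \<in> refined n O\<^sub>0" "L \<in> neighbours h (refined n O\<^sub>0) K" for K L
      proof -
        have L: "L \<in> refined n O\<^sub>0" "K \<in> neighbours h (refined n O\<^sub>0) L"
          using that neighbours_sym by (auto simp: neighbours_def)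
        have "\<sigma> (center h K) - \<sigma> (center h L) \<le> p / 2 ^ (n + 1) * \<sigma> (center h L)"
          using rel[OF L] by linarith
        also have "\<dots> \<le> p / 2 * \<sigma> (center h L)"
          using half center_pos[OF L(1)] by (intro mult_right_mono) simp_all
        finally show ?thesis by (simp add: q_def algebra_simps)
      qed
      interpret fv_octree h N "refined n O\<^sub>0" prec \<sigma> q
        using graded_refined[OF assms(1,3,4)] center_pos ratio_q q by unfold_locales
      define \<epsilon> where "\<epsilon> = \<kappa> / 2 ^ n"
      define M where "M = (1 + jump_factor q) * m * 2 ^ n"
      have two: "1 \<le> (2 :: real) ^ n" by simp
      have M: "1 \<le> M" unfolding M_def using mult_mono[OF c1 two] c1 by simp
      have "0 \<le> \<epsilon>" using \<open>0 \<le> \<kappa>\<close> by (simp add: \<epsilon>_def)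
      have m2: "1 \<le> m * 2 ^ n" using mult_mono[OF m two] m by simp
      have "\<tau> (subcell n C i) \<le> (1 + jump_factor q) ^ 3 * ((M + 3 * 2 ^ n) * (1 + \<epsilon>) ^ (3 * 2 ^ n))"
      proof (rule estimator_subcell[OF refl less.prems M \<open>0 \<le> \<epsilon>\<close>])
        fix i :: "nat ^ 3" and d assume i: "\<And>e. i $ e \<in> {1..2 ^ n}" and "i $ d = 1"
        let ?K = "subcell n C i"
        have K: "?K \<in> refined n O\<^sub>0" using subcell_in_refined less.prems i .
        have lower_K: "lower h ?K $ d = lower h C $ d" using \<open>i $ d = 1\<close> by (simp add: lower_subcell)
        show "\<tau> ?K \<le> M"
        proof (cases "lower h ?K $ d = 0")
          case True
          then have "\<tau> ?K \<le> (1 + jump_factor q) * 1" using estimator_boundary[OF K] by simp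
          also have "\<dots> \<le> (1 + jump_factor q) * (m * 2 ^ n)" using J m2 by (intro mult_left_mono) simp_all
          finally show ?thesis by (simp add: M_def mult_ac)
        next
          case False
          then have "0 < lower h ?K $ d" using octree_in_domain(1)[OF octree h_pos K, of d] by simp
          then obtain L where L: "L \<in> refined n O\<^sub>0" "face_below h d L ?K"
            using exists_face_below[OF K] by blast
          then obtain D j where D: "D \<in> O\<^sub>0" "L = subcell n D j" and j: "\<And>d. j $ d \<in> {1..2 ^ n}"
            unfolding refined_eq_subcells by blast
          \<comment> \<open>\<open>K\<close> lies at the lower face of \<open>C\<close>, so \<open>L\<close> belongs to an earlier cell of the original octree,
            where the induction hypothesis applies.\<close>
          have "D \<noteq> C"
          proof
            assume "D = C"
            have "lower h D $ d \<le> lower h L $ d" unfolding D(2) by (rule subcell_within[OF h_pos j])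
            also have "\<dots> < upper h L $ d" by (rule lower_lt_upper)
            also have "\<dots> = lower h D $ d" using L(2) lower_K \<open>D = C\<close> by (simp add: face_below_def)
            finally show False by simp
          qed
          moreover have "dominated h D C"
            using dominated_subcell[OF h_pos j i] face_below_dominated[OF h_pos L(2)] D(2) by blast
          ultimately have "prec\<^sub>0 D C" using coarse.dominated_prec D(1) less.prems by blast
          then have "\<tau> L \<le> f D * 2 ^ n"
            using f[OF D(1)] order j unfolding est_bounded_def D(2) by blast
          also have "\<dots> \<le> m * 2 ^ n"
            using f_le[OF D(1) \<open>prec\<^sub>0 D C\<close>] by (intro mult_right_mono) simp_all
          finally have "jump_factor q * \<tau> L \<le> jump_factor q * (m * 2 ^ n)" using J by (rule mult_left_mono)
          then have "\<tau> ?K \<le> m * 2 ^ n + jump_factor q * (m * 2 ^ n)"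
            using estimator_jump[OF K L] m2 by linarith
          then show ?thesis by (simp add: M_def algebra_simps)
        qed
      next
        fix K L L'
        assume K: "K \<in> refined n O\<^sub>0" and L: "L \<in> neighbours h (refined n O\<^sub>0) K"
          and L': "L' \<in> neighbours h (refined n O\<^sub>0) K"
          and lev: "level L = level K" "level L' = level K"
        define s u v where "s = \<sigma> (center h K)" "u = \<sigma> (center h L)" "v = \<sigma> (center h L')"
        have pos: "0 < s" "0 < u" "0 < v"
          using K L L' center_pos by (auto simp: s_u_v_def neighbours_def)
        \<comment> \<open>The coefficients at \<open>L\<close> and \<open>L'\<close> are both compared with that at \<open>K\<close>.\<close>
        have "\<bar>u - s\<bar> \<le> p / 2 ^ (n + 1) * s" "\<bar>v - s\<bar> \<le> p / 2 ^ (n + 1) * s"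
          using rel[OF K L] rel[OF K L'] by (simp_all only: s_u_v_def)
        then have "u - v \<le> p / 2 ^ (n + 1) * s + p / 2 ^ (n + 1) * s" by linarith
        also have "\<dots> = p / 2 ^ n * s" by (simp add: field_simps)
        finally have uv: "u - v \<le> p / 2 ^ n * s" .
        have "s \<le> q * v" using ratio_q[OF K L'] by (simp only: s_u_v_def)
        with uv pos have "inverse (inverse s + inverse u) \<le>
            (1 + p / 2 ^ n * q) * inverse (inverse s + inverse v)"
          using \<open>0 \<le> p\<close> by (intro harmonic_mean_ratio) simp_all
        then have "2 * edge h K * inverse (inverse s + inverse u) \<le>
            2 * edge h K * ((1 + p / 2 ^ n * q) * inverse (inverse s + inverse v))"
          using edge_pos[OF h_pos, of K] by (intro mult_left_mono) simp_all
        moreover have "weight h \<sigma> K L = 2 * edge h K * inverse (inverse s + inverse u)"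
          "weight h \<sigma> K L' = 2 * edge h K * inverse (inverse s + inverse v)"
          using lev by (simp_all add: weight_def coupling_def s_u_v_def)
        moreover have "\<epsilon> = p / 2 ^ n * q" by (simp add: \<epsilon>_def \<kappa>_def)
        ultimately show "weight h \<sigma> K L \<le> (1 + \<epsilon>) * weight h \<sigma> K L'" by (simp only: mult_ac)
      qed (use i in blast)
      also have "\<dots> \<le> (1 + jump_factor q) ^ 3 * ((M + 3 * 2 ^ n) * exp (3 * \<kappa>))"
        unfolding \<epsilon>_def using J M \<open>0 \<le> \<kappa>\<close>
        by (intro mult_left_mono one_plus_power_le_exp) simp_all
      also have "\<dots> = c * 2 ^ n" by (simp add: c_def M_def algebra_simps)
      finally show ?thesis .
    qed
    then show ?case unfolding est_bounded_def by blast
  qed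
  then obtain f where f: "\<And>C. C \<in> O\<^sub>0 \<Longrightarrow> est_bounded (f C) C" by metis
  define V where "V = f ` O\<^sub>0"
  have "f C \<le> Max V" if "C \<in> O\<^sub>0" for C
    using coarse.finite_cells that by (auto simp: V_def intro!: Max_ge)
  then have "f C * 2 ^ n \<le> Max V * 2 ^ n" if "C \<in> O\<^sub>0" for C n
    using that by (intro mult_right_mono) simp_all
  then show ?thesis
    using f unfolding est_bounded_def by (intro exI[of _ "Max V"]) (meson order_trans)
qed

end
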